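(* Every point of the unit circle $\mathbb T=\{q\in\mathbb C:|q|=1\}$ is an accumulation point of the spectrum of the partial theta function: $$\overline{\operatorname{Spec}(\Theta)}\cap\mathbb T=\mathbb T .$$
   Context: Let $\mathbb D=\{q\in\mathbb C:|q|<1\}$. The partial theta function is $\Theta(q,x)=\sum_{j=0}^{\infty}q^{j(j+1)/2}x^j$ for $|q|<1$, $x\in\mathbb C$. Its complex spectrum is $$\operatorname{Spec}(\Theta)=\{q\in\mathbb D:\ \exists x\in\mathbb C\text{ such that }\Theta(q,x)=\partial_x\Theta(q,x)=0\}.$$ The overline denotes closure in $\mathbb C$. *)

theory Defs
  imports "HOL-Analysis.Analysis"
begin

(* j * (j + 1) is even, so the natural-number division in the exponent is exact.
   For norm q < 1 the series converges for every x and is entire in x; for other q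
   the value of suminf may be meaningless, and it is never used below. *)
definition partial_theta :: "complex \<Rightarrow> complex \<Rightarrow> complex" where
  "partial_theta q x = (\<Sum>j. q ^ (j * (j + 1) div 2) * x ^ j)"

definition partial_theta_spectrum :: "complex set" where
  "partial_theta_spectrum =
     {q \<in> ball 0 1. \<exists>x. partial_theta q x = 0 \<and> deriv (partial_theta q) x = 0}"

end

theory Submission
  imports Defs "HOL-Complex_Analysis.Complex_Analysis" "HOL-Real_Asymp.Real_Asymp"
begin

text \<open>
  Write \<open>\<Theta>\<close> for the partial theta function. The roots of unity of odd order are dense in the circle, so
  it is enough to find points of the spectrum arbitrarily close to each such root of unity
  \<open>\<zeta>\<close>, say with \<open>\<zeta>^m = 1\<close> and \<open>m\<close> odd (\<open>spectrum_near_odd_root_of_unity\<close>). Suppose there are none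
  near \<open>\<zeta>\<close>. Then all zeros \<open>x\<close> of \<open>\<Theta>(q, x)\<close> with \<open>q\<close> near \<open>\<zeta>\<close> in the unit disc are simple, and a
  normal family argument leads to a contradiction.

  Rescale by \<open>q = \<zeta> exp(-\<tau>/n)\<close>, where \<open>n\<close> is a multiple of \<open>m\<close>; then \<open>q^n = exp(-\<tau>)\<close>, and for large \<open>n\<close>
  every \<open>\<tau>\<close> in a fixed disc of the right half-plane is admissible. Let
  \<open>J(q, y) = \<Theta>(q, y) + \<Theta>(q, 1/y)/y\<close> be the full Jacobi theta function. The shift
  \<open>J(q, qy) = J(q, y)/(qy)\<close> turns \<open>\<Theta>(q, y/q^k) = 0\<close> into
  \<open>J(q, y) = q^(k(k+1)/2) y^(-k-1) \<Theta>(q, q^k/y)\<close>, whose right-hand side is tiny for large \<open>k\<close>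
  (\<open>partial_theta_shift_zero_iff\<close>). The triple product formula gives quantitative control of \<open>J\<close>, with
  three consequences.

  \<^item> \<open>J\<close> vanishes at \<open>y = -1\<close> but is not too small on a small circle around it. For \<open>\<tau>\<close> in \<open>[6, 7]\<close> the
    error term loses against this lower bound, so \<open>\<Theta>(q, _)\<close> has a zero \<open>(1 + O(1/n)) (- exp \<tau>)\<close>, and
    no zero leaves the small disc around \<open>- exp \<tau>\<close> as \<open>\<tau>\<close> varies (\<open>outer_zero\<close>).

  \<^item> \<open>\<Theta>(q, _)\<close> has no zeros on the circles \<open>|x| = |q|^(-k-1/2)\<close> for all large \<open>k\<close>, uniformly for
    \<open>|q| \<le> r1 < 1\<close> (\<open>partial_theta_nonzero_on_circles\<close>). So zeros cannot escape to infinity, and a simple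
    zero can be continued holomorphically over closed discs in the right half-plane (\<open>disc_branch\<close>).

  \<^item> For real \<open>Q\<close> in \<open>(0, 1)\<close> and \<open>X\<close> slightly outside the unit disc near \<open>-1\<close>, all factors of the
    product are at most \<open>1\<close> in modulus, and one of them is \<open>1 - Q\<close>. Hence \<open>J(Q, X)\<close> tends to \<open>0\<close>
    as \<open>Q\<close> tends to \<open>1\<close>, and \<open>\<Theta>(Q, X)\<close> tends to \<open>1/(1 - X)\<close> even outside the unit disc
    (\<open>partial_theta_tendsto_outside\<close>). Splitting the series by residues modulo \<open>m\<close> transfers this to
    \<open>\<zeta>\<close> (\<open>partial_theta_tendsto_at_root_of_unity\<close>): for small \<open>\<tau> > 0\<close>, the values of \<open>\<Theta>\<close> near
    \<open>x = - exp \<tau>\<close> tend to a rational function of \<open>x\<close> that is nonzero for suitable \<open>\<tau>\<close>.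

  The reciprocals of the continued zeros are holomorphic on a disc containing both \<open>[6, 7]\<close> and that
  small \<open>\<tau>\<close>. They are bounded by \<open>2\<close>, because zeros of \<open>\<Theta>\<close> satisfy \<open>|x| \<ge> 1/2\<close>. By Montel's theorem a
  subsequence converges; the limit is \<open>- exp(-\<tau>)\<close> on \<open>[6, 7]\<close>, hence everywhere. So there are zeros of
  \<open>\<Theta>\<close> tending to \<open>- exp \<tau>\<close> also for the small \<open>\<tau>\<close>, where the limit of \<open>\<Theta>\<close> is nonzero.
\<close>

section \<open>The partial theta function and its derivative\<close>

definition tri :: "nat \<Rightarrow> nat" where
  "tri j = j * (j + 1) div 2"

lemma tri_0 [simp]: "tri 0 = 0"
  by (simp add: tri_def)

lemma tri_Suc: "tri (Suc n) = tri n + Suc n"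
  by (simp add: tri_def)

lemma double_tri: "2 * tri n = n * (n + 1)"
  by (induction n) (auto simp: tri_Suc algebra_simps)

lemma partial_theta_tri: "partial_theta q x = (\<Sum>j. q ^ tri j * x ^ j)"
  by (simp add: partial_theta_def tri_def)

text \<open>
  The weight \<open>j + 1\<close> makes one majorant serve both the series and its derivative in \<open>x\<close>.
\<close>

lemma summable_tri_majorant:
  fixes \<rho> M :: real
  assumes "0 \<le> \<rho>" "\<rho> < 1" "0 \<le> M"
  shows "summable (\<lambda>j. real (Suc j) * (\<rho> ^ tri j * M ^ j))"
proof -
  have "(\<lambda>n. \<rho> ^ Suc n * (2 * M)) \<longlonglongrightarrow> 0 * (2 * M)"
    by (rule tendsto_mult[OF LIMSEQ_Suc[OF LIMSEQ_realpow_zero] tendsto_const]) (use assms in auto)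
  hence "eventually (\<lambda>n. \<rho> ^ Suc n * (2 * M) < 1 / 2) sequentially"
    by (intro order_tendstoD(2)) auto
  then obtain N where N: "\<And>n. n \<ge> N \<Longrightarrow> \<rho> ^ Suc n * (2 * M) < 1 / 2"
    by (auto simp: eventually_at_top_linorder)
  show ?thesis
  proof (rule summable_ratio_test[of "1/2" N])
    fix n assume n: "n \<ge> N"
    define a where "a = \<rho> ^ tri n * M ^ n"
    have a: "a \<ge> 0" using assms by (simp add: a_def)
    have "real (Suc (Suc n)) * (\<rho> ^ tri (Suc n) * M ^ Suc n) =
          (real (Suc (Suc n)) * a) * (\<rho> ^ Suc n * M)"
      by (simp add: tri_Suc power_add a_def mult_ac)
    also have "\<dots> \<le> ((2 * real (Suc n)) * a) * (\<rho> ^ Suc n * M)"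
      using assms a by (intro mult_right_mono) auto
    also have "\<dots> = (real (Suc n) * a) * (\<rho> ^ Suc n * (2 * M))"
      by simp
    also have "\<dots> \<le> (real (Suc n) * a) * (1 / 2)"
      using N[OF n] a by (intro mult_left_mono) auto
    finally show "norm (real (Suc (Suc n)) * (\<rho> ^ tri (Suc n) * M ^ Suc n))
        \<le> 1 / 2 * norm (real (Suc n) * (\<rho> ^ tri n * M ^ n))"
      using assms by (simp add: a_def abs_mult mult_ac)
  qed simp
qed

lemma norm_tri_term_le:
  fixes q x c :: complex
  assumes "norm q \<le> \<rho>" "\<rho> < 1" "norm x \<le> M" "norm c \<le> real (Suc j)" "tri j \<le> e"
  shows "norm (c * (q ^ e * x ^ j)) \<le> real (Suc j) * (\<rho> ^ tri j * M ^ j)"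
proof -
  have \<rho>: "0 \<le> \<rho>" "0 \<le> M"
    using assms norm_ge_zero order_trans by blast+
  have "norm q ^ e \<le> \<rho> ^ e"
    using assms by (intro power_mono) auto
  also have "\<dots> \<le> \<rho> ^ tri j"
    using assms \<rho> by (intro power_decreasing) auto
  finally have 1: "norm q ^ e \<le> \<rho> ^ tri j" .
  have 2: "norm x ^ j \<le> M ^ j"
    using assms by (intro power_mono) auto
  have "norm c * (norm q ^ e * norm x ^ j) \<le> real (Suc j) * (\<rho> ^ tri j * M ^ j)"
    using assms \<rho> 1 2 by (intro mult_mono) auto
  thus ?thesis by (simp add: norm_mult norm_power)
qed

lemma tri_series_uniform_limit:
  fixes c :: "nat \<Rightarrow> complex" and e :: "nat \<Rightarrow> nat"
  assumes "\<And>j. norm (c j) \<le> real (Suc j)" "\<And>j. tri j \<le> e j" "\<rho> < 1"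
  shows "uniform_limit (cball 0 \<rho> \<times> cball 0 M)
           (\<lambda>N (q, x). \<Sum>j<N. c j * (q ^ e j * x ^ j))
           (\<lambda>(q, x). \<Sum>j. c j * (q ^ e j * x ^ j)) sequentially"
proof (cases "0 \<le> \<rho> \<and> 0 \<le> M")
  case True
  have "uniform_limit (cball 0 \<rho> \<times> cball 0 M)
           (\<lambda>N z. \<Sum>j<N. c j * (fst z ^ e j * snd z ^ j))
           (\<lambda>z. \<Sum>j. c j * (fst z ^ e j * snd z ^ j)) sequentially"
  proof (rule Weierstrass_m_test)
    show "summable (\<lambda>j. real (Suc j) * (\<rho> ^ tri j * M ^ j))"
      using True assms(3) by (intro summable_tri_majorant) auto
    show "norm (c j * (fst z ^ e j * snd z ^ j)) \<le> real (Suc j) * (\<rho> ^ tri j * M ^ j)"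
      if "z \<in> cball 0 \<rho> \<times> cball 0 M" for j z
      using that by (intro norm_tri_term_le assms) auto
  qed
  thus ?thesis unfolding case_prod_unfold .
next
  case False
  hence "cball (0::complex) \<rho> \<times> cball (0::complex) M = {}" by auto
  thus ?thesis by (simp only: uniform_limit_on_empty)
qed

lemma tri_series_summable:
  fixes q x :: complex and c :: "nat \<Rightarrow> complex"
  assumes "norm q < 1" "\<And>j. norm (c j) \<le> real (Suc j)" "\<And>j. tri j \<le> e j"
  shows "summable (\<lambda>j. c j * (q ^ e j * x ^ j))"
proof (rule summable_comparison_test'[of _ 0])
  show "summable (\<lambda>j. real (Suc j) * (norm q ^ tri j * norm x ^ j))"
    using assms(1) by (intro summable_tri_majorant) auto
  show "norm (c j * (q ^ e j * x ^ j)) \<le> real (Suc j) * (norm q ^ tri j * norm x ^ j)" for j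
    by (rule norm_tri_term_le) (rule assms order_refl)+
qed

lemma tri_series_continuous:
  fixes c :: "nat \<Rightarrow> complex"
  assumes "\<And>j. norm (c j) \<le> real (Suc j)" "\<And>j. tri j \<le> e j"
  shows "continuous_on (ball 0 1 \<times> UNIV) (\<lambda>(q, x). \<Sum>j. c j * (q ^ e j * x ^ j))"
    (is "continuous_on _ ?f")
proof -
  have "isCont ?f z" if z: "z \<in> ball 0 1 \<times> UNIV" for z
  proof -
    obtain q x where [simp]: "z = (q, x)" by (cases z)
    obtain \<rho> where \<rho>: "norm q < \<rho>" "\<rho> < 1" using dense z by auto
    let ?S = "ball 0 \<rho> \<times> ball 0 (norm x + 1)"
    have "continuous_on (cball 0 \<rho> \<times> cball 0 (norm x + 1)) ?f"
      by (rule uniform_limit_theorem[OF _ tri_series_uniform_limit])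
         (use assms \<rho> in \<open>auto intro!: always_eventually continuous_intros
            simp: case_prod_unfold simp del: of_nat_Suc\<close>)
    hence "continuous_on ?S ?f"
      by (rule continuous_on_subset) auto
    moreover have "open ?S" by (intro open_Times) auto
    moreover have "z \<in> ?S" using \<rho> by auto
    ultimately show ?thesis using continuous_on_eq_continuous_at by blast
  qed
  thus ?thesis by (simp add: continuous_at_imp_continuous_on)
qed

lemma partial_theta_continuous:
  "continuous_on (ball 0 1 \<times> UNIV) (\<lambda>(q, x). partial_theta q x)"
  using tri_series_continuous[of "\<lambda>_. 1" tri] by (simp add: partial_theta_tri)

lemma summable_partial_theta:
  "norm q < 1 \<Longrightarrow> summable (\<lambda>j. q ^ tri j * x ^ j)" for q x :: complex
  using tri_series_summable[of q "\<lambda>_. 1" tri x] by simp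

lemma partial_theta_has_field_derivative:
  assumes "norm q < 1"
  shows "(partial_theta q has_field_derivative
           (\<Sum>j. of_nat (Suc j) * (q ^ tri (Suc j) * x ^ j))) (at x)"
proof -
  have "((\<lambda>x. \<Sum>j. q ^ tri j * x ^ j) has_field_derivative
          (\<Sum>j. diffs (\<lambda>j. q ^ tri j) j * x ^ j)) (at x)"
    using summable_partial_theta[OF assms]
    by (intro termdiffs_strong_converges_everywhere)
  also have "(\<lambda>x. \<Sum>j. q ^ tri j * x ^ j) = partial_theta q"
    by (simp add: fun_eq_iff partial_theta_tri)
  finally show ?thesis by (simp add: diffs_def mult.assoc)
qed

lemma deriv_partial_theta:
  assumes "norm q < 1"
  shows "(partial_theta q has_field_derivative deriv (partial_theta q) x) (at x)"
  using partial_theta_has_field_derivative[OF assms] DERIV_imp_deriv by metis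

lemma deriv_partial_theta_continuous:
  "continuous_on (ball 0 1 \<times> UNIV) (\<lambda>(q, x). deriv (partial_theta q) x)"
proof -
  have "continuous_on (ball 0 1 \<times> UNIV)
          (\<lambda>(q, x). \<Sum>j. of_nat (Suc j) * (q ^ tri (Suc j) * (x::complex) ^ j))"
    by (rule tri_series_continuous) (auto simp: tri_Suc norm_of_nat simp del: of_nat_Suc)
  thus ?thesis
    by (rule continuous_on_eq)
       (auto simp: DERIV_imp_deriv[OF partial_theta_has_field_derivative] simp del: of_nat_Suc)
qed

text \<open>
  Holomorphy in both variables at once, in the form needed to follow a moving zero: the partial sums
  converge uniformly as long as \<open>q\<close> and \<open>g\<close> stay in compact sets.
\<close>

lemma partial_theta_comp_holomorphic:
  assumes U: "open U" and q: "q holomorphic_on U" and g: "g holomorphic_on U"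
    and lt: "\<And>t. t \<in> U \<Longrightarrow> norm (q t) < 1"
  shows "(\<lambda>t. partial_theta (q t) (g t)) holomorphic_on U"
proof (rule holomorphic_uniform_sequence[OF U])
  show "(\<lambda>t. \<Sum>j<N. 1 * (q t ^ tri j * g t ^ j)) holomorphic_on U" for N
    by (intro holomorphic_intros q g)
next
  fix t assume t: "t \<in> U"
  obtain d where d: "d > 0" "cball t d \<subseteq> U"
    using U t open_contains_cball by blast
  have cq: "continuous_on (cball t d) (\<lambda>t. norm (q t))"
   and cg: "continuous_on (cball t d) (\<lambda>t. norm (g t))"
    using d(2) q g holomorphic_on_imp_continuous_on continuous_on_subset
    by (blast intro: continuous_on_norm)+
  obtain t1 where t1: "t1 \<in> cball t d" "\<And>s. s \<in> cball t d \<Longrightarrow> norm (q s) \<le> norm (q t1)"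
    using continuous_attains_sup[OF compact_cball _ cq] d(1) by auto
  obtain t2 where t2: "t2 \<in> cball t d" "\<And>s. s \<in> cball t d \<Longrightarrow> norm (g s) \<le> norm (g t2)"
    using continuous_attains_sup[OF compact_cball _ cg] d(1) by auto
  have "uniform_limit (cball t d)
          (\<lambda>N s. (\<lambda>(q, x). \<Sum>j<N. 1 * (q ^ tri j * x ^ j)) (q s, g s))
          (\<lambda>s. (\<lambda>(q, x). \<Sum>j. 1 * (q ^ tri j * x ^ j)) (q s, g s)) sequentially"
    by (rule uniform_limit_compose'[OF tri_series_uniform_limit
             [of "\<lambda>_. 1" tri "norm (q t1)" "norm (g t2)"]])
       (use t1 t2 d lt in auto)
  thus "\<exists>d>0. cball t d \<subseteq> U \<and> uniform_limit (cball t d)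
           (\<lambda>N t. \<Sum>j<N. 1 * (q t ^ tri j * g t ^ j)) (\<lambda>t. partial_theta (q t) (g t)) sequentially"
    using d by (auto simp: partial_theta_tri)
qed

lemma partial_theta_holomorphic:
  assumes "norm q < 1"
  shows "partial_theta q holomorphic_on S"
  using deriv_partial_theta[OF assms]
  by (meson field_differentiable_at_within field_differentiable_def holomorphic_on_def)

lemma partial_theta_functional_equation:
  assumes "norm q < 1"
  shows "partial_theta q x = 1 + q * x * partial_theta q (q * x)"
proof -
  have "partial_theta q x = 1 + (\<Sum>j. q ^ tri (Suc j) * x ^ Suc j)"
    using suminf_split_head[OF summable_partial_theta[OF assms, of x]]
    by (simp add: partial_theta_tri)
  also have "(\<lambda>j. q ^ tri (Suc j) * x ^ Suc j) = (\<lambda>j. q * x * (q ^ tri j * (q * x) ^ j))"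
    by (simp add: tri_Suc power_add power_mult_distrib fun_eq_iff mult_ac)
  also have "(\<Sum>j. q * x * (q ^ tri j * (q * x) ^ j)) = q * x * partial_theta q (q * x)"
    using suminf_mult[OF summable_partial_theta[OF assms, of "q*x"]]
    by (simp add: partial_theta_tri)
  finally show ?thesis .
qed

lemma norm_partial_theta_minus_1_le:
  assumes "norm q < 1" "norm x < 1"
  shows "norm (partial_theta q x - 1) \<le> norm x / (1 - norm x)"
proof -
  have sm: "summable (\<lambda>j. norm x * norm x ^ j)"
    using assms by (intro summable_mult summable_geometric) auto
  have le: "norm (q ^ tri (Suc j) * x ^ Suc j) \<le> norm x * norm x ^ j" for j
    using mult_mono[OF power_le_one[of "norm q" "tri (Suc j)"] order_refl, of "norm x ^ Suc j"] assms
    by (simp add: norm_mult norm_power)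
  have "partial_theta q x - 1 = (\<Sum>j. q ^ tri (Suc j) * x ^ Suc j)"
    using suminf_split_head[OF summable_partial_theta[OF assms(1), of x]]
    by (simp add: partial_theta_tri)
  also have "norm \<dots> \<le> (\<Sum>j. norm x * norm x ^ j)"
    by (rule norm_suminf_le[OF le sm])
  also have "\<dots> = norm x / (1 - norm x)"
    using assms suminf_mult[of "\<lambda>j. norm x ^ j" "norm x"] suminf_geometric[of "norm x"]
      summable_geometric[of "norm x"] by auto
  finally show ?thesis .
qed

lemma norm_partial_theta_le_2:
  assumes "norm q < 1" "norm x \<le> 1 / 2"
  shows "norm (partial_theta q x) \<le> 2"
proof -
  have "norm (partial_theta q x - 1) \<le> norm x / (1 - norm x)"
    using assms by (intro norm_partial_theta_minus_1_le) auto
  also have "\<dots> \<le> 1" using assms by (simp add: field_simps)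
  finally show ?thesis
    using norm_triangle_ineq2[of "partial_theta q x" 1] by simp
qed

text \<open>
  The constant term \<open>1\<close> dominates the tail of the series for \<open>|x| < 1/2\<close>. This makes the reciprocals of
  zeros a bounded, hence normal, family.
\<close>

lemma partial_theta_zero_norm_ge:
  assumes "norm q < 1" "partial_theta q x = 0"
  shows "norm x \<ge> 1 / 2"
proof (rule ccontr)
  assume "\<not> ?thesis"
  hence x: "norm x < 1 / 2" by simp
  hence "norm (partial_theta q x - 1) \<le> norm x / (1 - norm x)"
    using assms by (intro norm_partial_theta_minus_1_le) auto
  also have "\<dots> < 1" using x by (simp add: field_simps)
  finally show False using assms by simp
qed

section \<open>The Jacobi theta function and the triple product\<close>

text \<open>
  This is the bilateral series \<open>\<Sum>j. q^(j(j+1)/2) y^j\<close> over all integers \<open>j\<close>: the index \<open>-1 - j\<close> carries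
  the same power of \<open>q\<close> as \<open>j\<close>, so the negative half is again a partial theta function.
\<close>

definition jacobi_theta :: "complex \<Rightarrow> complex \<Rightarrow> complex" where
  "jacobi_theta q y = partial_theta q y + partial_theta q (1 / y) / y"

lemma jacobi_theta_shift:
  assumes "norm q < 1" "q \<noteq> 0" "y \<noteq> 0"
  shows "q * y * jacobi_theta q (q * y) = jacobi_theta q y"
proof -
  have "q * y * jacobi_theta q (q * y) =
        q * y * partial_theta q (q * y) + partial_theta q (1 / (q * y))"
    using assms by (simp add: jacobi_theta_def algebra_simps)
  also have "partial_theta q (1 / (q * y)) = 1 + partial_theta q (1 / y) / y"
    using partial_theta_functional_equation[OF assms(1), of "1 / (q * y)"] assms by simp
  also have "q * y * partial_theta q (q * y) = partial_theta q y - 1"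
    using partial_theta_functional_equation[OF assms(1), of y] by simp
  finally show ?thesis by (simp add: jacobi_theta_def)
qed

lemma jacobi_theta_shift_power:
  assumes "norm q < 1" "q \<noteq> 0" "y \<noteq> 0"
  shows "q ^ tri k * jacobi_theta q (y / q ^ k) = (q * y) ^ k * jacobi_theta q y"
proof (induction k)
  case (Suc k)
  have "jacobi_theta q (y / q ^ Suc k) = y / q ^ k * jacobi_theta q (y / q ^ k)"
    using jacobi_theta_shift[OF assms(1,2), of "y / q ^ Suc k"] assms by simp
  hence "q ^ tri (Suc k) * jacobi_theta q (y / q ^ Suc k) =
         q * y * (q ^ tri k * jacobi_theta q (y / q ^ k))"
    using assms by (simp add: tri_Suc power_add)
  also have "\<dots> = (q * y) ^ Suc k * jacobi_theta q y"
    by (simp add: Suc.IH)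
  finally show ?case .
qed simp

lemma partial_theta_shift_power:
  assumes "norm q < 1" "q \<noteq> 0" "y \<noteq> 0"
  shows "q ^ tri k * partial_theta q (y / q ^ k) =
         (q * y) ^ k * jacobi_theta q y - q ^ tri k * (q ^ k / y) * partial_theta q (q ^ k / y)"
proof -
  have "partial_theta q (y / q ^ k) =
        jacobi_theta q (y / q ^ k) - q ^ k / y * partial_theta q (q ^ k / y)"
    by (simp add: jacobi_theta_def)
  thus ?thesis
    using jacobi_theta_shift_power[OF assms, of k] by (simp add: right_diff_distrib)
qed

text \<open>
  Zeros of modulus about \<open>|q|^(-k)\<close> are moved to modulus about \<open>1\<close>, where they solve a perturbation of
  \<open>J(q, y) = 0\<close> with an error that decays like \<open>q^(k(k+1)/2)\<close>.
\<close>

lemma partial_theta_shift_zero_iff: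
  assumes "norm q < 1" "q \<noteq> 0" "y \<noteq> 0"
  shows "partial_theta q (y / q ^ k) = 0 \<longleftrightarrow>
         jacobi_theta q y = q ^ tri k / y ^ Suc k * partial_theta q (q ^ k / y)"
proof -
  have "partial_theta q (y / q ^ k) = 0 \<longleftrightarrow> q ^ tri k * partial_theta q (y / q ^ k) = 0"
    using assms by simp
  also have "q ^ tri k * partial_theta q (y / q ^ k) = (q * y) ^ k * (jacobi_theta q y -
                     q ^ tri k / y ^ Suc k * partial_theta q (q ^ k / y))"
    using assms by (subst partial_theta_shift_power)
      (auto simp: power_mult_distrib right_diff_distrib)
  also have "\<dots> = 0 \<longleftrightarrow> jacobi_theta q y - q ^ tri k / y ^ Suc k * partial_theta q (q ^ k / y) = 0"
    using assms by simp
  also have "\<dots> \<longleftrightarrow> jacobi_theta q y = q ^ tri k / y ^ Suc k * partial_theta q (q ^ k / y)"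
    using assms by simp
  finally show ?thesis .
qed

definition qfac :: "'a::comm_ring_1 \<Rightarrow> nat \<Rightarrow> 'a" where
  "qfac q n = (\<Prod>j<n. 1 - q ^ Suc j)"

lemma qfac_0 [simp]: "qfac q 0 = 1" and qfac_Suc: "qfac q (Suc n) = qfac q n * (1 - q ^ Suc n)"
  by (simp_all add: qfac_def)

lemma power_Suc_neq_1:
  fixes q :: complex
  assumes "norm q < 1"
  shows "q ^ Suc n \<noteq> 1"
proof
  assume "q ^ Suc n = 1"
  hence "norm q ^ Suc n = 1" by (metis norm_one norm_power)
  thus False using power_less_one_iff[of "norm q" "Suc n"] assms by (simp del: power_Suc)
qed

lemma qfac_nonzero: "norm q < 1 \<Longrightarrow> qfac q n \<noteq> 0" for q :: complex
  using power_Suc_neq_1[of q] by (auto simp: qfac_def simp del: power_Suc)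

definition qbinomial :: "complex \<Rightarrow> nat \<Rightarrow> nat \<Rightarrow> complex" where
  "qbinomial q n k = (if k \<le> n then qfac q n / (qfac q k * qfac q (n - k)) else 0)"

lemma qbinomial_0: "norm q < 1 \<Longrightarrow> qbinomial q n 0 = 1"
  using qfac_nonzero[of q] by (simp add: qbinomial_def)

lemma qbinomial_Suc_Suc:
  assumes "norm q < 1" "k \<le> n"
  shows "qbinomial q (Suc n) (Suc k) = qbinomial q n (Suc k) + q ^ (n - k) * qbinomial q n k"
proof (cases "k = n")
  case True
  thus ?thesis using assms qfac_nonzero[OF assms(1)] by (simp add: qbinomial_def)
next
  case False
  define m where "m = n - Suc k"
  have n: "n = Suc k + m" using False assms by (simp add: m_def)
  have nz: "qfac q k \<noteq> 0" "qfac q m \<noteq> 0" "1 - q ^ Suc k \<noteq> 0" "1 - q ^ Suc m \<noteq> 0"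
    using assms(1) qfac_nonzero[of q] power_Suc_neq_1[of q] by (auto simp del: power_Suc)
  have "qfac q (Suc n) = qfac q n * (1 - q ^ Suc n)" by (rule qfac_Suc)
  also have "1 - q ^ Suc n = (1 - q ^ Suc m) + q ^ Suc m * (1 - q ^ Suc k)"
    by (simp add: n power_add algebra_simps)
  finally have eq: "qfac q (Suc n) = qfac q n * ((1 - q ^ Suc m) + q ^ Suc m * (1 - q ^ Suc k))" .
  define a b where "a = 1 - q ^ Suc k" and "b = 1 - q ^ Suc m"
  have nz': "a \<noteq> 0" "b \<noteq> 0" using nz by (simp_all add: a_def b_def)
  have 1: "qbinomial q (Suc n) (Suc k) =
           qfac q n * (b + q ^ Suc m * a) / (qfac q k * a * (qfac q m * b))"
    unfolding qbinomial_def eq by (simp add: n qfac_Suc a_def b_def)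
  have 2: "qbinomial q n (Suc k) = qfac q n / (qfac q k * a * qfac q m)"
    unfolding qbinomial_def by (simp add: n qfac_Suc a_def)
  have 3: "qbinomial q n k = qfac q n / (qfac q k * (qfac q m * b))"
    unfolding qbinomial_def by (simp add: n qfac_Suc b_def)
  have 4: "n - k = Suc m" by (simp add: n)
  show ?thesis unfolding 1 2 3 4 using nz nz' by (simp add: field_simps)
qed

text \<open>
  Multiplying by the next factor \<open>1 + z q^(n+1)\<close> is the Pascal rule for the coefficients, because
  \<open>tri (k + 1) = tri k + (k + 1)\<close>.
\<close>

lemma q_binomial_theorem:
  assumes "norm q < 1"
  shows "(\<Prod>j<n. 1 + z * q ^ Suc j) = (\<Sum>k\<le>n. qbinomial q n k * q ^ tri k * z ^ k)"
proof (induction n)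
  case 0
  show ?case using qbinomial_0[OF assms] by simp
next
  case (Suc n)
  define A where "A = (\<lambda>k. qbinomial q n k * q ^ tri k * z ^ k)"
  have "(\<Prod>j<Suc n. 1 + z * q ^ Suc j) = (\<Sum>k\<le>n. A k) + (\<Sum>k\<le>n. z * q ^ Suc n * A k)"
    using Suc.IH by (simp add: A_def sum_distrib_left[symmetric] algebra_simps)
  also have "(\<Sum>k\<le>n. A k) = (\<Sum>k\<le>Suc n. A k)"
    by (simp add: A_def qbinomial_def)
  also have "\<dots> = A 0 + (\<Sum>k\<le>n. A (Suc k))"
    by (rule sum.atMost_Suc_shift)
  also have "A 0 + (\<Sum>k\<le>n. A (Suc k)) + (\<Sum>k\<le>n. z * q ^ Suc n * A k)
      = A 0 + (\<Sum>k\<le>n. A (Suc k) + z * q ^ Suc n * A k)"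
    by (simp add: sum.distrib)
  also have "(\<Sum>k\<le>n. A (Suc k) + z * q ^ Suc n * A k) =
             (\<Sum>k\<le>n. qbinomial q (Suc n) (Suc k) * q ^ tri (Suc k) * z ^ Suc k)"
  proof (rule sum.cong)
    fix k assume "k \<in> {..n}"
    hence k: "k \<le> n" by simp
    have qn: "q ^ Suc n = q ^ (n - k) * q ^ Suc k"
      using k by (simp flip: power_add)
    show "A (Suc k) + z * q ^ Suc n * A k = 
          qbinomial q (Suc n) (Suc k) * q ^ tri (Suc k) * z ^ Suc k"
      unfolding A_def qn qbinomial_Suc_Suc[OF assms k] tri_Suc power_add by (simp add: algebra_simps)
  qed simp
  also have "A 0 = qbinomial q (Suc n) 0 * q ^ tri 0 * z ^ 0"
    using qbinomial_0[OF assms] by (simp add: A_def)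
  also have "\<dots> + (\<Sum>k\<le>n. qbinomial q (Suc n) (Suc k) * q ^ tri (Suc k) * z ^ Suc k) =
             (\<Sum>k\<le>Suc n. qbinomial q (Suc n) k * q ^ tri k * z ^ k)"
    by (rule sum.atMost_Suc_shift[symmetric])
  finally show ?case .
qed

lemma qbinomial_symmetric: "k \<le> n \<Longrightarrow> qbinomial q n (n - k) = qbinomial q n k"
  by (simp add: qbinomial_def mult.commute)

text \<open>
  The \<open>q\<close>-binomial theorem with \<open>2N\<close> factors at \<open>z = y/q^N\<close>: the first \<open>N\<close> factors contain the powers
  \<open>y/q^j\<close> and are turned into \<open>1 + q^j/y\<close> by extracting the constant \<open>c\<close>.
\<close>

lemma finite_triple_product:
  assumes q: "norm q < 1" "q \<noteq> 0" and y: "y \<noteq> 0"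
  shows "(\<Prod>j<N. (1 + y * q ^ Suc j) * (1 + q ^ j / y)) =
     (\<Sum>j\<le>N. qbinomial q (2 * N) (N + j) * (q ^ tri j * y ^ j)) +
     (\<Sum>j<N. qbinomial q (2 * N) (N + Suc j) * (q ^ tri j * (1 / y) ^ Suc j))"
    (is "?P = ?A + ?B")
proof -
  define z where "z = y / q ^ N"
  define S where "S = (\<Sum>j<N. j)"
  define c where "c = y ^ N / q ^ S"
  define T where "T = (\<lambda>k. qbinomial q (2 * N) k * q ^ tri k * z ^ k)"
  have S: "2 * S + N = N * N" unfolding S_def
    by (induction N) (auto simp: algebra_simps)
  have c: "c \<noteq> 0" using q y by (simp add: c_def)
  have "(\<Prod>j<2 * N. 1 + z * q ^ Suc j) =
        (\<Prod>j<N. 1 + z * q ^ Suc j) * (\<Prod>j=N..<N+N. 1 + z * q ^ Suc j)"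
    by (simp only: lessThan_atLeast0 mult_2 prod.atLeastLessThan_concat le_add1 zero_le)
  also have "(\<Prod>j=N..<N+N. 1 + z * q ^ Suc j) = (\<Prod>j<N. 1 + z * q ^ Suc (N + j))"
    using prod.shift_bounds_nat_ivl[of "\<lambda>j. 1 + z * q ^ Suc j" 0 N N]
    by (simp add: lessThan_atLeast0 add.commute)
  also have "\<dots> = (\<Prod>j<N. 1 + y * q ^ Suc j)"
    using q by (simp add: z_def power_add)
  also have "(\<Prod>j<N. 1 + z * q ^ Suc j) = (\<Prod>j<N. 1 + z * q ^ Suc (N - Suc j))"
    by (rule prod.nat_diff_reindex[symmetric])
  also have "\<dots> = (\<Prod>j<N. y / q ^ j * (1 + q ^ j / y))"
  proof (rule prod.cong)
    fix j assume "j \<in> {..<N}"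
    hence "q ^ N = q ^ j * q ^ Suc (N - Suc j)"
      by (simp flip: power_add power_Suc)
    hence "z * q ^ Suc (N - Suc j) = y / q ^ j"
      using q by (simp add: z_def)
    thus "1 + z * q ^ Suc (N - Suc j) = y / q ^ j * (1 + q ^ j / y)"
      using q y by (simp add: field_simps)
  qed simp
  also have "\<dots> = c * (\<Prod>j<N. 1 + q ^ j / y)"
    by (simp add: prod.distrib prod_dividef c_def S_def power_sum)
  finally have "(\<Prod>j<2 * N. 1 + z * q ^ Suc j) = c * ?P"
    by (simp add: prod.distrib)
  moreover have "(\<Prod>j<2 * N. 1 + z * q ^ Suc j) = sum T {..2 * N}"
    unfolding T_def by (rule q_binomial_theorem[OF q(1)])
  moreover have "sum T {..2 * N} = sum T {..<N} + sum T {N..N + N}"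
  proof -
    have "{..2 * N} = {..<N} \<union> {N..N + N}" by auto
    thus ?thesis by (simp add: sum.union_disjoint ivl_disj_int)
  qed
  moreover have "sum T {N..N + N} = (\<Sum>j\<le>N. T (N + j))"
    using sum.shift_bounds_cl_nat_ivl[of T 0 N N] by (simp add: atMost_atLeast0 add.commute)
  moreover have "\<dots> = c * ?A"
    unfolding sum_distrib_left
  proof (rule sum.cong)
    fix j
    have "2 * (tri (N + j) + S) = 2 * (N * (N + j) + tri j)"
      using S double_tri[of j] double_tri[of "N + j"] by (simp add: algebra_simps)
    hence "tri (N + j) + S = N * (N + j) + tri j" unfolding mult_cancel1 by simp
    hence "q ^ tri (N + j) * q ^ S = q ^ (N * (N + j)) * q ^ tri j"
      by (metis power_add)
    thus "T (N + j) = c * (qbinomial q (2 * N) (N + j) * (q ^ tri j * y ^ j))"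
      using q y by (simp add: T_def c_def z_def power_divide power_mult[symmetric])
        (simp add: field_simps power_add)
  qed simp
  moreover have "sum T {..<N} = (\<Sum>j<N. T (N - Suc j))"
    by (rule sum.nat_diff_reindex[symmetric])
  moreover have "\<dots> = c * ?B"
    unfolding sum_distrib_left
  proof (rule sum.cong)
    fix j assume "j \<in> {..<N}"
    then obtain i where N: "N = i + Suc j"
      by (metis add.commute le_Suc_ex lessThan_iff Suc_leI)
    have sym: "qbinomial q (2 * N) i = qbinomial q (2 * N) (N + Suc j)"
      using qbinomial_symmetric[of "N + Suc j" "2 * N" q] by (simp add: N mult_2)
    have "2 * (tri i + S) = 2 * (N * i + tri j)"
      using S double_tri[of j] double_tri[of i] by (simp add: N algebra_simps)
    hence "tri i + S = N * i + tri j" unfolding mult_cancel1 by simp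
    hence "q ^ tri i * q ^ S = q ^ (N * i) * q ^ tri j"
      by (metis power_add)
    hence eq: "q ^ tri i * z ^ i = c * (q ^ tri j * (1 / y) ^ Suc j)"
      using q y by (simp add: c_def z_def power_divide power_mult[symmetric] del: power_Suc)
        (simp add: field_simps power_add N)
    have "T i = qbinomial q (2 * N) (N + Suc j) * (q ^ tri i * z ^ i)"
      unfolding T_def sym by (rule mult.assoc)
    also have "\<dots> = c * (qbinomial q (2 * N) (N + Suc j) * (q ^ tri j * (1 / y) ^ Suc j))"
      unfolding eq by (rule mult.left_commute)
    also have "i = N - Suc j" by (simp add: N)
    finally show "T (N - Suc j) = c * (qbinomial q (2 * N) (N + Suc j) * (q ^ tri j * (1 / y) ^ Suc j))" .
  qed simp
  ultimately have "c * ?P = c * (?A + ?B)"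
    by (simp add: distrib_left add.commute)
  thus ?thesis using c by simp
qed


lemma qfac_limit:
  fixes q :: complex
  assumes "norm q < 1"
  obtains L where "L \<noteq> 0" "qfac q \<longlonglongrightarrow> L"
proof -
  have "abs_convergent_prod (\<lambda>j. 1 - q ^ Suc j)"
    unfolding abs_convergent_prod_conv_summable
    using assms by (auto simp: norm_mult norm_power intro!: summable_mult summable_geometric)
  hence "convergent_prod (\<lambda>j. 1 - q ^ Suc j)"
    by (rule abs_convergent_prod_imp_convergent_prod)
  moreover have "1 - q ^ Suc j \<noteq> 0" for j
    using power_Suc_neq_1[OF assms, of j] by simp
  ultimately obtain L where "L \<noteq> 0" "(\<lambda>n. \<Prod>j\<le>n. 1 - q ^ Suc j) \<longlonglongrightarrow> L"
    using convergent_prod_iff_nz_lim[of "\<lambda>j. 1 - q ^ Suc j"] by auto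
  moreover from this have "qfac q \<longlonglongrightarrow> L"
    unfolding qfac_def[abs_def] LIMSEQ_lessThan_iff_atMost by blast
  ultimately show ?thesis using that by blast
qed

text \<open>
  The coefficient of the finite triple product normalised by \<open>qfac q N\<close>. With this factor it tends to
  \<open>1\<close> for every fixed \<open>i\<close>, and it is bounded uniformly in \<open>N\<close> and \<open>i\<close>; both facts rest on
  \<open>qfac q\<close> having a nonzero limit.
\<close>

definition triple_coeff :: "complex \<Rightarrow> nat \<Rightarrow> nat \<Rightarrow> complex" where
  "triple_coeff q N i = qfac q N * qbinomial q (2 * N) (N + i)"

lemma triple_coeff_tendsto:
  assumes "norm q < 1"
  shows "(\<lambda>N. triple_coeff q N i) \<longlonglongrightarrow> 1"
proof -
  obtain L where L: "L \<noteq> 0" "qfac q \<longlonglongrightarrow> L" using qfac_limit[OF assms] .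
  have lim: "(\<lambda>N. qfac q (f N)) \<longlonglongrightarrow> L" if "filterlim f at_top at_top" for f
    using filterlim_compose[OF L(2) that] .
  have "(\<lambda>N. qfac q N * (qfac q (N + N) / (qfac q (N + i) * qfac q (N - i)))) \<longlonglongrightarrow> L * (L / (L * L))"
  proof (intro tendsto_mult tendsto_divide)
    show "(\<lambda>N. qfac q (N + N)) \<longlonglongrightarrow> L"
      by (rule lim, rule filterlim_subseq) (simp add: strict_mono_def)
    show "(\<lambda>N. qfac q (N + i)) \<longlonglongrightarrow> L" "(\<lambda>N. qfac q (N - i)) \<longlonglongrightarrow> L"
      by (rule lim, rule filterlim_add_const_nat_at_top filterlim_minus_const_nat_at_top)+
  qed (use L in auto)
  also have "L * (L / (L * L)) = 1" using L by simp
  finally show ?thesis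
  proof (rule Lim_transform_eventually)
    show "\<forall>\<^sub>F N in sequentially. qfac q N * (qfac q (N + N) / (qfac q (N + i) * qfac q (N - i))) =
            triple_coeff q N i"
      using eventually_ge_at_top[of i]
      by eventually_elim (auto simp: triple_coeff_def qbinomial_def mult_2)
  qed
qed

lemma triple_coeff_bounded:
  assumes "norm q < 1"
  obtains C where "C \<ge> 0" "\<And>N i. norm (triple_coeff q N i) \<le> C"
proof -
  obtain L where L: "L \<noteq> 0" "qfac q \<longlonglongrightarrow> L" using qfac_limit[OF assms] .
  have "Bseq (qfac q)" "Bseq (\<lambda>n. inverse (qfac q n))"
    using L(2) tendsto_inverse[OF L(2,1)] by (meson convergentI convergent_imp_Bseq)+
  then obtain A B where A: "\<And>n. norm (qfac q n) \<le> A" and B: "\<And>n. norm (inverse (qfac q n)) \<le> B"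
    by (meson BseqD)
  have nn: "A \<ge> 0" "B \<ge> 0" using A B norm_ge_zero order_trans by blast+
  have "norm (triple_coeff q N i) \<le> A * (A * (B * B))" for N i
  proof (cases "i \<le> N")
    case True
    hence "triple_coeff q N i =
        qfac q N * (qfac q (2 * N) * (inverse (qfac q (N + i)) * inverse (qfac q (N - i))))"
      by (simp add: triple_coeff_def qbinomial_def field_simps mult_2)
    also have "norm \<dots> \<le> A * (A * (B * B))"
      unfolding norm_mult by (intro mult_mono A B mult_nonneg_nonneg norm_ge_zero nn)
    finally show ?thesis .
  qed (use nn in \<open>auto simp: triple_coeff_def qbinomial_def\<close>)
  thus ?thesis using that[of "A * (A * (B * B))"] nn by simp
qed

lemma tendsto_triple_coeff_series:
  assumes "norm q < 1" "\<And>j. norm (t j) \<le> M j" "summable M"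
  shows "(\<lambda>N. \<Sum>j. triple_coeff q N (f j) * t j) \<longlonglongrightarrow> (\<Sum>j. t j)"
proof -
  obtain C where C: "C \<ge> 0" "\<And>N i. norm (triple_coeff q N i) \<le> C"
    using triple_coeff_bounded[OF assms(1)] by metis
  have lim: "(\<lambda>N. triple_coeff q N (f j) * t j) \<longlonglongrightarrow> 1 * t j" for j
    by (rule tendsto_mult[OF triple_coeff_tendsto[OF assms(1)] tendsto_const])
  have "norm (triple_coeff q N (f j) * t j) \<le> C * M j" for N j
    unfolding norm_mult by (rule mult_mono[OF C(2) assms(2) C(1) norm_ge_zero])
  hence bound: "\<forall>\<^sub>F (j, N) in sequentially \<times>\<^sub>F sequentially. norm (triple_coeff q N (f j) * t j) \<le> C * M j"
    by (intro always_eventually) (simp add: case_prod_unfold)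
  have "(\<lambda>N. \<Sum>j. triple_coeff q N (f j) * t j) \<longlonglongrightarrow> (\<Sum>j. 1 * t j)"
    by (rule conjunct2[OF conjunct2[OF tannerys_theorem[OF lim bound summable_mult[OF assms(3)]
          sequentially_bot]]])
  thus ?thesis by (simp only: mult_1)
qed

text \<open>
  The limit of the finite identity, by dominated convergence. It is stated as a limit of finite
  products because both bounds deduced from it hold already for the finite products.
\<close>

theorem jacobi_triple_product:
  assumes q: "norm q < 1" "q \<noteq> 0" and y: "y \<noteq> 0"
  shows "(\<lambda>N. qfac q N * (\<Prod>j<N. (1 + y * q ^ Suc j) * (1 + q ^ j / y))) \<longlonglongrightarrow> jacobi_theta q y"
proof -
  have sm: "summable (\<lambda>j. real (Suc j) * (norm q ^ tri j * norm x ^ j))" for x :: complex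
    using q by (intro summable_tri_majorant) auto
  have le: "norm (q ^ tri j * x ^ j) \<le> real (Suc j) * (norm q ^ tri j * norm x ^ j)" for x j
    using norm_tri_term_le[of q "norm q" x "norm x" 1 j] q by simp
  have 1: "(\<lambda>N. \<Sum>j. triple_coeff q N j * (q ^ tri j * y ^ j)) \<longlonglongrightarrow> partial_theta q y"
    unfolding partial_theta_tri by (rule tendsto_triple_coeff_series[OF q(1) le sm])
  have 2: "(\<lambda>N. \<Sum>j. triple_coeff q N (Suc j) * (q ^ tri j * (1 / y) ^ j)) \<longlonglongrightarrow> partial_theta q (1 / y)"
    unfolding partial_theta_tri by (rule tendsto_triple_coeff_series[OF q(1) le sm])
  have "(\<lambda>N. (\<Sum>j. triple_coeff q N j * (q ^ tri j * y ^ j)) +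
             (\<Sum>j. triple_coeff q N (Suc j) * (q ^ tri j * (1 / y) ^ j)) / y)
          \<longlonglongrightarrow> jacobi_theta q y"
    unfolding jacobi_theta_def by (intro tendsto_intros 1 2 y)
  also have "(\<lambda>N. (\<Sum>j. triple_coeff q N j * (q ^ tri j * y ^ j)) +
                  (\<Sum>j. triple_coeff q N (Suc j) * (q ^ tri j * (1 / y) ^ j)) / y) =
     (\<lambda>N. qfac q N * (\<Prod>j<N. (1 + y * q ^ Suc j) * (1 + q ^ j / y)))"
  proof
    fix N
    have "(\<Sum>j. triple_coeff q N j * (q ^ tri j * y ^ j)) =
          (\<Sum>j\<le>N. triple_coeff q N j * (q ^ tri j * y ^ j))"
      by (rule suminf_finite) (auto simp: triple_coeff_def qbinomial_def)
    moreover have "(\<Sum>j. triple_coeff q N (Suc j) * (q ^ tri j * (1 / y) ^ j)) =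
          (\<Sum>j<N. triple_coeff q N (Suc j) * (q ^ tri j * (1 / y) ^ j))"
      by (rule suminf_finite) (auto simp: triple_coeff_def qbinomial_def)
    ultimately show "(\<Sum>j. triple_coeff q N j * (q ^ tri j * y ^ j)) +
                  (\<Sum>j. triple_coeff q N (Suc j) * (q ^ tri j * (1 / y) ^ j)) / y =
       qfac q N * (\<Prod>j<N. (1 + y * q ^ Suc j) * (1 + q ^ j / y))"
      unfolding finite_triple_product[OF q y]
      by (simp add: distrib_left sum_distrib_left sum_divide_distrib triple_coeff_def mult_ac)
  qed
  finally show ?thesis .
qed

section \<open>Bounds for the Jacobi theta function\<close>

text \<open>
  Expanding \<open>- ln (1 - s^j)\<close> into a power series and summing over \<open>j\<close> first leaves terms
  \<open>w/((m+1)(1 - w))\<close> with \<open>w = s^(m+1)\<close>. Since \<open>1 - w \<ge> (1 - s) (m+1) w\<close>, they sum to at most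
  \<open>\<pi>^2/6 < 2\<close> times \<open>1/(1 - s)\<close>.
\<close>

lemma qfac_lower_bound:
  fixes s :: real
  assumes "0 < s" "s < 1"
  shows "qfac s N \<ge> exp (- 2 / (1 - s))"
proof -
  define a where "a = (\<lambda>m j. (s ^ Suc j) ^ Suc m / real (Suc m))"
  have u: "0 < s ^ Suc j" "s ^ Suc j < 1" for j
    using assms power_Suc_less_one[of s j] by auto
  have sm: "summable (\<lambda>m. a m j)" for j
  proof (rule summable_comparison_test'[of "\<lambda>m. (s ^ Suc j) ^ Suc m" 0])
    show "summable (\<lambda>m. (s ^ Suc j) ^ Suc m)"
      using u[of j] by (subst summable_Suc_iff) (auto intro!: summable_geometric)
    show "norm (a m j) \<le> (s ^ Suc j) ^ Suc m" for m
      using assms divide_left_mono[of 1 "real (Suc m)" "(s ^ Suc j) ^ Suc m"] by (simp add: a_def)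
  qed
  have ln: "- ln (1 - s ^ Suc j) = (\<Sum>m. a m j)" for j
  proof -
    have "ln (1 - s ^ Suc j) = (\<Sum>n. (- 1) ^ n * (1 / real (n + 1)) * (1 - s ^ Suc j - 1) ^ Suc n)"
      using u[of j] by (intro ln_series) auto
    also have "(\<lambda>n. (- 1) ^ n * (1 / real (n + 1)) * (1 - s ^ Suc j - 1) ^ Suc n) = (\<lambda>n. - a n j)"
    proof
      fix n
      have "1 - s ^ Suc j - 1 = - (s ^ Suc j)" by simp
      thus "(- 1) ^ n * (1 / real (n + 1)) * (1 - s ^ Suc j - 1) ^ Suc n = - a n j"
        by (cases "even n") (simp_all add: a_def)
    qed
    finally show ?thesis using suminf_minus[OF sm[of j]] by simp
  qed
  have term_le: "(\<Sum>j<N. a m j) \<le> 1 / (1 - s) * (1 / (real m + 1)\<^sup>2)" for m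
  proof -
    define w where "w = s ^ Suc m"
    have w: "0 < w" "w < 1" using u[of m] by (auto simp: w_def)
    have "(\<Sum>j<N. w ^ Suc j) \<le> (\<Sum>j. w ^ Suc j)"
      using w by (intro sum_le_suminf) (auto intro!: summable_mult summable_geometric)
    also have "\<dots> = w / (1 - w)"
      using w suminf_mult[of "\<lambda>j. w ^ j" w] suminf_geometric[of w] summable_geometric[of w] by simp
    finally have 1: "(\<Sum>j<N. w ^ Suc j) \<le> w / (1 - w)" .
    have "(real m + 1) * w \<le> (\<Sum>i<Suc m. s ^ i)"
    proof -
      have "(\<Sum>i<Suc m. w) \<le> (\<Sum>i<Suc m. s ^ i)"
        unfolding w_def using assms by (intro sum_mono power_decreasing) auto
      thus ?thesis by (simp add: algebra_simps)
    qed
    hence "(1 - s) * ((real m + 1) * w) \<le> (1 - s) * (\<Sum>i<Suc m. s ^ i)"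
      using assms by (intro mult_left_mono) auto
    also have "\<dots> = 1 - w"
      using one_diff_power_eq[of s "Suc m"] by (simp add: w_def)
    finally have "((1 - s) * (real m + 1)) * w \<le> 1 - w" by (simp only: mult.assoc)
    moreover have "(1 - s) * (real m + 1) > 0" using assms by simp
    ultimately have 2: "w / (1 - w) \<le> 1 / ((1 - s) * (real m + 1))"
      using w by (simp only: divide_simps) (simp add: mult.commute)
    have "(\<Sum>j<N. a m j) = (\<Sum>j<N. w ^ Suc j) / real (Suc m)"
      unfolding a_def w_def sum_divide_distrib
      by (simp only: power_mult[symmetric] mult.commute)
    also have "\<dots> \<le> 1 / ((1 - s) * (real m + 1)) / real (Suc m)"
      using 1 2 by (intro divide_right_mono) auto
    also have "\<dots> = 1 / (1 - s) * (1 / (real m + 1)\<^sup>2)"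
      by (simp add: power2_eq_square)
    finally show ?thesis .
  qed
  have sums: "(\<lambda>m. 1 / (1 - s) * (1 / (real m + 1)\<^sup>2)) sums (1 / (1 - s) * (pi\<^sup>2 / 6))"
    using sums_mult[OF inverse_squares_sums, of "1 / (1 - s)"] by (simp add: add.commute)
  have "- (\<Sum>j<N. ln (1 - s ^ Suc j)) = (\<Sum>m. \<Sum>j<N. a m j)"
    using suminf_sum[of "{..<N}" "\<lambda>j m. a m j"] sm ln by (simp add: sum_negf[symmetric])
  also have "\<dots> \<le> 1 / (1 - s) * (pi\<^sup>2 / 6)"
    using suminf_le[OF term_le summable_sum sums_summable[OF sums]] sm sums_unique[OF sums] by simp
  also have "\<dots> \<le> 1 / (1 - s) * 2"
  proof (intro mult_left_mono)
    have "pi\<^sup>2 \<le> 3.2\<^sup>2" using pi_approx by (intro power_mono) auto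
    thus "pi\<^sup>2 / 6 \<le> 2" by (simp add: power2_eq_square)
  qed (use assms in auto)
  finally have le: "- 2 / (1 - s) \<le> (\<Sum>j<N. ln (1 - s ^ Suc j))" by simp
  have "qfac s N = exp (\<Sum>j<N. ln (1 - s ^ Suc j))"
    unfolding qfac_def exp_sum[OF finite_lessThan] using u by (intro prod.cong) auto
  thus ?thesis using le by simp
qed

text \<open>
  On the annulus \<open>s \<le> |y| \<le> 1/s\<close>, where \<open>s^2 = |q|\<close>, the only factor of the triple product that may be
  small is \<open>1 + 1/y\<close>. Each of the three remaining families of factors is at least \<open>1 - s^j\<close>, so
  \<open>qfac_lower_bound\<close> is used three times, which explains the constant \<open>6\<close>.
\<close>

lemma jacobi_theta_lower_bound:
  assumes q: "norm q < 1" "q \<noteq> 0" and s: "s = sqrt (norm q)" and y: "s \<le> norm y" "norm y * s \<le> 1"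
  shows "norm (1 + 1 / y) * exp (- 6 / (1 - s)) \<le> norm (jacobi_theta q y)"
proof -
  have s01: "0 < s" "s < 1" using q by (auto simp: s)
  have r: "norm q = s ^ 2" using q by (simp add: s)
  have y0: "y \<noteq> 0" using s01 y by auto
  define E where "E = exp (- 2 / (1 - s))"
  have E: "E > 0" by (simp add: E_def)
  have prod_le: "E \<le> norm (\<Prod>j<N. 1 + f j)" if "\<And>j. norm (f j) \<le> s ^ Suc j" for f :: "nat \<Rightarrow> complex" and N
  proof -
    have "E \<le> qfac s N" unfolding E_def by (rule qfac_lower_bound[OF s01])
    also have "\<dots> \<le> (\<Prod>j<N. norm (1 + f j))"
      unfolding qfac_def
    proof (rule prod_mono)
      fix j
      have "1 \<le> norm (1 + f j) + norm (f j)"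
        using norm_triangle_ineq4[of "1 + f j" "f j"] by simp
      thus "0 \<le> 1 - s ^ Suc j \<and> 1 - s ^ Suc j \<le> norm (1 + f j)"
        using that[of j] power_Suc_less_one[of s j] s01 by auto
    qed
    finally show ?thesis by (simp add: prod_norm)
  qed
  have dec: "s ^ a \<le> s ^ b" if "b \<le> a" for a b
    using s01 that by (intro power_decreasing) auto
  have A: "E \<le> norm (qfac q N)" for N
    using prod_le[of "\<lambda>j. - (q ^ Suc j)" N] dec
    by (simp add: qfac_def norm_mult norm_power r power_mult[symmetric] flip: power_add power_Suc)
  have B: "E \<le> norm (\<Prod>j<N. 1 + y * q ^ Suc j)" for N
  proof (rule prod_le)
    fix j
    have "norm (y * q ^ Suc j) = (norm y * s) * s ^ (2 * j + 1)"
      by (simp add: norm_mult norm_power r power_mult[symmetric] power2_eq_square mult_2 power_add power_mult_distrib)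
    also have "\<dots> \<le> 1 * s ^ Suc j"
      using y s01 dec by (intro mult_mono) auto
    finally show "norm (y * q ^ Suc j) \<le> s ^ Suc j" by simp
  qed
  have C: "E \<le> norm (\<Prod>j<N. 1 + q ^ Suc j / y)" for N
  proof (rule prod_le)
    fix j
    have "norm (q ^ Suc j / y) = s / norm y * s ^ (2 * j + 1)"
      by (simp add: norm_mult norm_divide norm_power r power_mult[symmetric] power2_eq_square mult_2 power_add power_mult_distrib)
    also have "\<dots> \<le> 1 * s ^ Suc j"
      using y s01 dec y0 by (intro mult_mono) auto
    finally show "norm (q ^ Suc j / y) \<le> s ^ Suc j" by simp
  qed
  have lower: "norm (1 + 1 / y) * exp (- 6 / (1 - s)) \<le>
          norm (qfac q (Suc N) * (\<Prod>j<Suc N. (1 + y * q ^ Suc j) * (1 + q ^ j / y)))" for N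
  proof -
    have "norm (1 + 1 / y) * exp (- 6 / (1 - s)) = E * (E * (norm (1 + 1 / y) * E))"
      by (simp add: E_def mult_ac flip: exp_add)
    also have "\<dots> \<le> norm (qfac q (Suc N)) * (norm (\<Prod>j<Suc N. 1 + y * q ^ Suc j) *
                 (norm (1 + 1 / y) * norm (\<Prod>j<N. 1 + q ^ Suc j / y)))"
      using E by (intro mult_mono A B C mult_nonneg_nonneg) auto
    also have "\<dots> = norm (qfac q (Suc N) * ((\<Prod>j<Suc N. 1 + y * q ^ Suc j) * (\<Prod>j<Suc N. 1 + q ^ j / y)))"
      by (simp only: prod.lessThan_Suc_shift[of "\<lambda>j. 1 + q ^ j / y"] norm_mult power_0)
    finally show ?thesis by (simp only: prod.distrib)
  qed
  show ?thesis
    by (rule tendsto_lowerbound[OF tendsto_norm[OF LIMSEQ_Suc[OF jacobi_triple_product[OF q y0]]]])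
       (use lower in auto)
qed

text \<open>
  For \<open>0 \<le> p \<le> 1\<close> the point \<open>1 + zp\<close> lies between \<open>1\<close> and \<open>1 + z\<close>. Hence under the two assumptions on
  \<open>X\<close> every factor of the triple product has modulus at most \<open>1\<close>, and the first one is \<open>1 - Q\<close>. The
  admissible \<open>X\<close> include points outside the unit disc, such as \<open>- exp \<sigma>\<close> with \<open>0 \<le> \<sigma> \<le> ln 2\<close>.
\<close>

lemma jacobi_theta_upper_bound:
  fixes Q :: real
  assumes Q: "0 < Q" "Q < 1" and X: "norm (1 + X) \<le> 1" "norm (1 + 1 / X) \<le> 1" "X \<noteq> 0"
  shows "norm (jacobi_theta (of_real Q) X) \<le> 1 - Q"
proof -
  have conv: "norm (1 + z * of_real p) \<le> 1" if "norm (1 + z) \<le> 1" "0 \<le> p" "p \<le> 1" for z :: complex and p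
  proof -
    have "1 + z * of_real p = of_real (1 - p) + of_real p * (1 + z)"
      by (simp add: algebra_simps)
    also have "norm \<dots> \<le> norm (complex_of_real (1 - p)) + norm (of_real p * (1 + z))"
      by (rule norm_triangle_ineq)
    also have "\<dots> = (1 - p) + p * norm (1 + z)"
      using that by (simp add: norm_mult del: of_real_diff)
    also have "\<dots> \<le> 1" using that mult_left_mono[of "norm (1 + z)" 1 p] by simp
    finally show ?thesis .
  qed
  have pw: "0 \<le> Q ^ j" "Q ^ j \<le> 1" for j
    using Q power_le_one[of Q j] by auto
  have upper: "norm (qfac (of_real Q) (Suc N) *
          (\<Prod>j<Suc N. (1 + X * of_real Q ^ Suc j) * (1 + of_real Q ^ j / X))) \<le> 1 - Q" for N
  proof -
    have "qfac (complex_of_real Q) (Suc N) = of_real (qfac Q (Suc N))"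
      by (simp add: qfac_def)
    hence "norm (qfac (complex_of_real Q) (Suc N)) = \<bar>qfac Q (Suc N)\<bar>" by (simp only: norm_of_real)
    also have "qfac Q (Suc N) = (1 - Q) * (\<Prod>j<N. 1 - Q ^ Suc (Suc j))"
      by (simp add: qfac_def prod.lessThan_Suc_shift del: prod.lessThan_Suc)
    also have "\<bar>\<dots>\<bar> \<le> (1 - Q) * 1"
      unfolding abs_mult abs_prod
    proof (intro mult_mono prod_le_1)
      fix j
      show "0 \<le> \<bar>1 - Q ^ Suc (Suc j)\<bar> \<and> \<bar>1 - Q ^ Suc (Suc j)\<bar> \<le> 1"
        using pw[of "Suc (Suc j)"] by linarith
    qed (use Q in \<open>auto intro!: prod_nonneg\<close>)
    finally have 1: "norm (qfac (complex_of_real Q) (Suc N)) \<le> 1 - Q" by simp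
    have "norm (\<Prod>j<Suc N. (1 + X * of_real Q ^ Suc j) * (1 + of_real Q ^ j / X)) \<le> 1"
      unfolding prod_norm[symmetric] norm_mult
    proof (intro prod_le_1 conjI mult_nonneg_nonneg norm_ge_zero mult_le_one)
      fix j
      show "norm (1 + X * of_real Q ^ Suc j) \<le> 1"
        using conv[OF X(1) pw[of "Suc j"]] by (simp del: power_Suc)
      show "norm (1 + of_real Q ^ j / X) \<le> 1"
        using conv[OF X(2) pw[of j]] by simp
    qed
    thus ?thesis using mult_mono[OF 1, of _ 1] Q by (simp add: norm_mult del: prod.lessThan_Suc)
  qed
  show ?thesis
    by (rule tendsto_upperbound[OF tendsto_norm[OF LIMSEQ_Suc[OF jacobi_triple_product]]])
       (use upper Q X in \<open>auto simp: norm_of_real\<close>)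
qed

section \<open>Limits of the partial theta function as q tends to 1\<close>

lemma partial_theta_tendsto_inside:
  assumes "\<And>n. norm (q n) < 1" "q \<longlonglongrightarrow> 1" "Y \<longlonglongrightarrow> Y0" "norm Y0 < 1"
  shows "(\<lambda>n. partial_theta (q n) (Y n)) \<longlonglongrightarrow> 1 / (1 - Y0)"
proof -
  obtain \<rho> where \<rho>: "norm Y0 < \<rho>" "\<rho> < 1" using dense assms(4) by blast
  have "\<forall>\<^sub>F n in sequentially. norm (Y n) < \<rho>"
    using order_tendstoD(2)[OF tendsto_norm[OF assms(3)] \<rho>(1)] .
  hence "\<forall>\<^sub>F z in sequentially \<times>\<^sub>F sequentially. norm (Y (snd z)) < \<rho>"
    using eventually_compose_filterlim filterlim_snd by blast
  hence "\<forall>\<^sub>F (j, n) in sequentially \<times>\<^sub>F sequentially. norm (q n ^ tri j * Y n ^ j) \<le> \<rho> ^ j"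
  proof eventually_elim
    case (elim z)
    have "norm (q (snd z)) ^ tri (fst z) * norm (Y (snd z)) ^ fst z \<le> 1 * \<rho> ^ fst z"
      using elim assms(1)[of "snd z"] by (intro mult_mono power_le_one power_mono) auto
    thus ?case by (simp add: case_prod_unfold norm_mult norm_power)
  qed
  moreover have "(\<lambda>n. q n ^ tri j * Y n ^ j) \<longlonglongrightarrow> 1 ^ tri j * Y0 ^ j" for j
    by (intro tendsto_intros assms)
  moreover have "summable (\<lambda>j. \<rho> ^ j)"
    using \<rho> le_less_trans[OF norm_ge_zero \<rho>(1)] by (intro summable_geometric) auto
  ultimately have "(\<lambda>n. \<Sum>j. q n ^ tri j * Y n ^ j) \<longlonglongrightarrow> (\<Sum>j. 1 ^ tri j * Y0 ^ j)"
    using tannerys_theorem[of "\<lambda>j n. q n ^ tri j * Y n ^ j" "\<lambda>j. 1 ^ tri j * Y0 ^ j" sequentially "\<lambda>j. \<rho> ^ j"]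
    by simp
  thus ?thesis using suminf_geometric[OF assms(4)] by (simp add: partial_theta_tri)
qed

text \<open>
  The limit is still \<open>1/(1 - X0)\<close>, although the terms of the series grow when \<open>|X0| > 1\<close>: the full
  theta function tends to \<open>0\<close> by \<open>jacobi_theta_upper_bound\<close>, and the complementary half of the
  bilateral series is evaluated at \<open>1/X0\<close>, inside the unit disc.
\<close>

lemma partial_theta_tendsto_outside:
  fixes Q :: "nat \<Rightarrow> real"
  assumes Q: "\<And>n. 0 < Q n" "\<And>n. Q n < 1" "Q \<longlonglongrightarrow> 1"
    and X: "X \<longlonglongrightarrow> X0" "norm X0 > 1" "norm (1 + X0) < 1" "norm (1 + 1 / X0) < 1"
  shows "(\<lambda>n. partial_theta (of_real (Q n)) (X n)) \<longlonglongrightarrow> 1 / (1 - X0)"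
proof -
  have X0: "X0 \<noteq> 0" "X0 \<noteq> 1" using X by auto
  have inv: "(\<lambda>n. 1 / X n) \<longlonglongrightarrow> 1 / X0" by (intro tendsto_intros X X0)
  have ev: "\<forall>\<^sub>F n in sequentially. norm (1 + X n) < 1" "\<forall>\<^sub>F n in sequentially. norm (1 + 1 / X n) < 1"
    "\<forall>\<^sub>F n in sequentially. X n \<noteq> 0"
    using order_tendstoD(2)[OF tendsto_norm[OF tendsto_add[OF tendsto_const[of 1] X(1)]] X(3)]
      order_tendstoD(2)[OF tendsto_norm[OF tendsto_add[OF tendsto_const[of 1] inv]] X(4)]
      tendsto_imp_eventually_ne[OF X(1) X0(1)] by auto
  have "(\<lambda>n. jacobi_theta (of_real (Q n)) (X n)) \<longlonglongrightarrow> 0"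
  proof (rule Lim_null_comparison)
    show "\<forall>\<^sub>F n in sequentially. norm (jacobi_theta (of_real (Q n)) (X n)) \<le> 1 - Q n"
      using ev by eventually_elim (use Q in \<open>auto intro!: jacobi_theta_upper_bound\<close>)
    show "(\<lambda>n. 1 - Q n) \<longlonglongrightarrow> 0" using tendsto_diff[OF tendsto_const Q(3), of 1] by simp
  qed
  moreover have "(\<lambda>n. partial_theta (of_real (Q n)) (1 / X n)) \<longlonglongrightarrow> 1 / (1 - 1 / X0)"
  proof (rule partial_theta_tendsto_inside[OF _ _ inv])
    show "norm (complex_of_real (Q n)) < 1" for n using Q(1,2)[of n] by simp
    show "(\<lambda>n. complex_of_real (Q n)) \<longlonglongrightarrow> 1" using tendsto_of_real[OF Q(3)] by simp
    show "norm (1 / X0) < 1" using X(2) by (auto simp: norm_divide divide_simps)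
  qed
  ultimately have "(\<lambda>n. jacobi_theta (of_real (Q n)) (X n) - partial_theta (of_real (Q n)) (1 / X n) / X n)
                     \<longlonglongrightarrow> 0 - 1 / (1 - 1 / X0) / X0"
    by (intro tendsto_intros X X0)
  moreover have "0 - 1 / (1 - 1 / X0) / X0 = 1 / (1 - X0)"
    using X0 by (simp add: divide_simps)
  ultimately show ?thesis by (simp add: jacobi_theta_def)
qed

section \<open>Continuation of simple zeros\<close>

text \<open>
  An implicit function theorem. With \<open>A\<close> the derivative at the given zero, the Newton map
  \<open>x \<mapsto> x - \<Theta>(q t, x)/A\<close> is a contraction near \<open>a\<close>, uniformly for \<open>t\<close> near \<open>p\<close>. Its fixed points are the
  zeros, which gives existence and uniqueness; its iterates from \<open>a\<close> are holomorphic in \<open>t\<close> and converge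
  uniformly, so the zero depends holomorphically on \<open>t\<close>.
\<close>

lemma local_zero_branch:
  assumes U: "open U" and q: "q holomorphic_on U" and lt: "\<And>t. t \<in> U \<Longrightarrow> norm (q t) < 1"
    and p: "p \<in> U" and zero: "partial_theta (q p) a = 0"
    and simple: "deriv (partial_theta (q p)) a \<noteq> 0"
  obtains \<eta> \<epsilon> \<phi> where "\<eta> > 0" "\<epsilon> > 0" "ball p \<eta> \<subseteq> U" "\<phi> holomorphic_on ball p \<eta>"
    "\<And>t. t \<in> ball p \<eta> \<Longrightarrow> partial_theta (q t) (\<phi> t) = 0"
    "\<And>t x. t \<in> ball p \<eta> \<Longrightarrow> x \<in> ball a \<epsilon> \<Longrightarrow> partial_theta (q t) x = 0 \<Longrightarrow> x = \<phi> t"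
proof -
  define A where "A = deriv (partial_theta (q p)) a"
  define G where "G = (\<lambda>t x. x - partial_theta (q t) x / A)"
  define D where "D = (\<lambda>z. 1 - deriv (partial_theta (q (fst z))) (snd z) / A)"
  have A: "A \<noteq> 0" using simple by (simp add: A_def)
  have cq: "continuous_on U q" by (rule holomorphic_on_imp_continuous_on[OF q])
  have cpair: "continuous_on (U \<times> UNIV) (\<lambda>z::complex \<times> complex. (q (fst z), snd z))"
    by (intro continuous_intros continuous_on_compose2[OF cq]) auto
  have "continuous_on (U \<times> UNIV)
          (\<lambda>z. (\<lambda>(q, x). deriv (partial_theta q) x) (q (fst z), snd z))"
    by (rule continuous_on_compose2[OF deriv_partial_theta_continuous cpair]) (use lt in auto)
  hence cD: "continuous_on (U \<times> UNIV) D"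
    unfolding D_def by (intro continuous_intros) (use A in auto)
  have "open (U \<times> (UNIV :: complex set))" using U by (intro open_Times) auto
  hence "isCont D (p, a)"
    using cD p by (simp add: continuous_on_eq_continuous_at)
  moreover have "D (p, a) = 0" using A by (simp add: D_def A_def)
  ultimately obtain d where d: "d > 0" "\<And>z. dist z (p, a) < d \<Longrightarrow> norm (D z) < 1 / 2"
    unfolding continuous_at_eps_delta by (metis dist_0_norm dist_commute half_gt_zero zero_less_one)
  define \<epsilon> where "\<epsilon> = d / 2"
  have \<epsilon>: "\<epsilon> > 0" using d by (simp add: \<epsilon>_def)
  have Dle: "norm (D (t, x)) \<le> 1 / 2" if "dist t p < \<epsilon>" "x \<in> ball a \<epsilon>" for t x
  proof -
    have "dist (t, x) (p, a) \<le> dist t p + dist x a"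
      by (simp add: dist_Pair_Pair sqrt_sum_squares_le_sum)
    also have "\<dots> < d" using that by (simp add: \<epsilon>_def dist_commute)
    finally show ?thesis using d(2) by (simp add: less_imp_le)
  qed
  have "continuous_on U (\<lambda>t. (\<lambda>(q, x). partial_theta q x) (q t, a))"
    by (rule continuous_on_compose2[OF partial_theta_continuous])
       (use lt cq in \<open>auto intro!: continuous_intros\<close>)
  hence "isCont (\<lambda>t. partial_theta (q t) a / A) p"
    using U p A by (auto simp: continuous_on_eq_continuous_at intro!: continuous_intros)
  then obtain \<eta>1 where \<eta>1: "\<eta>1 > 0"
      "\<And>t. dist t p < \<eta>1 \<Longrightarrow> dist (partial_theta (q t) a / A) (partial_theta (q p) a / A) < \<epsilon> / 4"
    unfolding continuous_at_eps_delta using \<epsilon> by (metis divide_pos_pos zero_less_numeral)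
  obtain \<eta>2 where \<eta>2: "\<eta>2 > 0" "ball p \<eta>2 \<subseteq> U" using U p open_contains_ball by blast
  define \<eta> where "\<eta> = min \<epsilon> (min \<eta>1 \<eta>2)"
  have \<eta>: "\<eta> > 0" "ball p \<eta> \<subseteq> U" using \<eta>1 \<eta>2 \<epsilon> by (auto simp: \<eta>_def)
  have lip: "dist (G t x) (G t y) \<le> 1 / 2 * dist x y"
    if t: "t \<in> ball p \<eta>" and xy: "x \<in> ball a \<epsilon>" "y \<in> ball a \<epsilon>" for t x y
  proof -
    have "norm (q t) < 1" using \<eta> t lt by blast
    hence "(G t has_field_derivative D (t, z)) (at z within ball a \<epsilon>)" for z
      unfolding G_def D_def using A
      by (auto intro!: derivative_eq_intros deriv_partial_theta[THEN DERIV_subset])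
    moreover have "norm (D (t, z)) \<le> 1 / 2" if "z \<in> ball a \<epsilon>" for z
      using that t by (intro Dle) (auto simp: \<eta>_def dist_commute)
    ultimately show ?thesis
      using field_differentiable_bound[of "ball a \<epsilon>" "G t" "\<lambda>z. D (t, z)" "1 / 2" y x] xy
      by (simp add: dist_norm norm_minus_commute)
  qed
  have Ga: "dist (G t a) a \<le> \<epsilon> / 4" if t: "t \<in> ball p \<eta>" for t
    using \<eta>1(2)[of t] t zero by (auto simp: G_def dist_norm \<eta>_def norm_minus_commute)
  have half: "cball a (\<epsilon> / 2) \<subseteq> ball a \<epsilon>" using \<epsilon> by auto
  have maps: "G t x \<in> cball a (\<epsilon> / 2)" if t: "t \<in> ball p \<eta>" and x: "x \<in> cball a (\<epsilon> / 2)" for t x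
  proof -
    have "dist (G t x) a \<le> dist (G t x) (G t a) + dist (G t a) a" by (rule dist_triangle)
    also have "\<dots> \<le> 1 / 2 * dist x a + \<epsilon> / 4"
      using x half \<epsilon> by (intro add_mono lip Ga t) auto
    also have "\<dots> \<le> \<epsilon> / 2" using x by (simp add: dist_commute)
    finally show ?thesis by (simp add: dist_commute)
  qed
  have "\<exists>!x\<in>cball a (\<epsilon> / 2). G t x = x" if t: "t \<in> ball p \<eta>" for t
  proof (rule Banach_fix[where c = "1 / 2"])
    show "complete (cball a (\<epsilon> / 2))" by (simp add: compact_imp_complete)
    show "G t ` cball a (\<epsilon> / 2) \<subseteq> cball a (\<epsilon> / 2)" using maps[OF t] by blast
    show "dist (G t x) (G t y) \<le> 1 / 2 * dist x y"
      if "x \<in> cball a (\<epsilon> / 2)" "y \<in> cball a (\<epsilon> / 2)" for x y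
      using lip[OF t] that half by blast
  qed (use \<epsilon> in auto)
  hence "\<forall>t\<in>ball p \<eta>. \<exists>x. x \<in> cball a (\<epsilon> / 2) \<and> G t x = x" by blast
  then obtain \<phi> where \<phi>: "\<And>t. t \<in> ball p \<eta> \<Longrightarrow> \<phi> t \<in> cball a (\<epsilon> / 2)"
      "\<And>t. t \<in> ball p \<eta> \<Longrightarrow> G t (\<phi> t) = \<phi> t"
    by metis
  have zero\<phi>: "partial_theta (q t) (\<phi> t) = 0" if "t \<in> ball p \<eta>" for t
    using \<phi>(2)[OF that] A by (simp add: G_def)
  have uniq: "x = \<phi> t" if t: "t \<in> ball p \<eta>" and x: "x \<in> ball a \<epsilon>" "partial_theta (q t) x = 0" for t x
  proof -
    have "dist (G t x) (G t (\<phi> t)) \<le> 1 / 2 * dist x (\<phi> t)"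
      using lip[OF t x(1)] \<phi>(1)[OF t] half by blast
    moreover have "G t x = x" using x by (simp add: G_def)
    ultimately show ?thesis using \<phi>(2)[OF t] by simp
  qed
  define X where "X = rec_nat (\<lambda>t. a) (\<lambda>_ f t. G t (f t))"
  have X0: "X 0 = (\<lambda>t. a)" and XSuc: "X (Suc n) = (\<lambda>t. G t (X n t))" for n
    by (simp_all add: X_def)
  have Xin: "X n t \<in> cball a (\<epsilon> / 2)" if "t \<in> ball p \<eta>" for n t
    by (induction n) (use that \<epsilon> maps in \<open>auto simp: X0 XSuc simp del: mem_cball\<close>)
  have Xconv: "dist (X n t) (\<phi> t) \<le> (1 / 2) ^ n * \<epsilon>" if t: "t \<in> ball p \<eta>" for n t
  proof (induction n)
    case 0
    show ?case using \<phi>(1)[OF t] \<epsilon> by (simp add: X0)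
  next
    case (Suc n)
    have "dist (X (Suc n) t) (\<phi> t) = dist (G t (X n t)) (G t (\<phi> t))"
      using \<phi>(2)[OF t] by (simp add: XSuc)
    also have "\<dots> \<le> 1 / 2 * dist (X n t) (\<phi> t)"
      using lip[OF t] Xin[OF t] \<phi>(1)[OF t] half by blast
    also have "\<dots> \<le> 1 / 2 * ((1 / 2) ^ n * \<epsilon>)" using Suc.IH by simp
    finally show ?case by simp
  qed
  have Xhol: "X n holomorphic_on ball p \<eta>" for n
  proof (induction n)
    case (Suc n)
    have "(\<lambda>t. partial_theta (q t) (X n t)) holomorphic_on ball p \<eta>"
      using \<eta> lt by (intro partial_theta_comp_holomorphic Suc.IH holomorphic_on_subset[OF q]) auto
    thus ?case unfolding XSuc G_def using A by (intro holomorphic_intros Suc.IH) auto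
  qed (simp add: X0)
  have "uniform_limit (ball p \<eta>) X \<phi> sequentially"
  proof (rule uniform_limitI)
    fix e :: real assume e: "e > 0"
    have "(\<lambda>n. (1 / 2) ^ n * \<epsilon>) \<longlonglongrightarrow> 0 * \<epsilon>"
      by (rule tendsto_mult[OF LIMSEQ_realpow_zero tendsto_const]) auto
    hence "\<forall>\<^sub>F n in sequentially. (1 / 2) ^ n * \<epsilon> < e"
      using e by (simp add: order_tendstoD(2))
    thus "\<forall>\<^sub>F n in sequentially. \<forall>x\<in>ball p \<eta>. dist (X n x) (\<phi> x) < e"
      by eventually_elim (blast intro: le_less_trans Xconv)
  qed
  hence "\<phi> holomorphic_on ball p \<eta>"
  proof (intro holomorphic_uniform_sequence[OF open_ball Xhol])
    fix x assume "x \<in> ball p \<eta>"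
    then obtain d where "d > 0" "cball x d \<subseteq> ball p \<eta>"
      using open_contains_cball open_ball by metis
    thus "\<exists>d>0. cball x d \<subseteq> ball p \<eta> \<and> uniform_limit (cball x d) X \<phi> sequentially"
      using \<open>uniform_limit (ball p \<eta>) X \<phi> sequentially\<close> uniform_limit_on_subset by blast
  qed
  thus ?thesis using that[of \<eta> \<epsilon> \<phi>] \<eta> \<epsilon> zero\<phi> uniq by blast
qed

definition zero_branch :: "(complex \<Rightarrow> complex) \<Rightarrow> complex set \<Rightarrow> (complex \<Rightarrow> complex) \<Rightarrow> bool" where
  "zero_branch q S \<phi> \<longleftrightarrow> \<phi> holomorphic_on S \<and> (\<forall>t\<in>S. partial_theta (q t) (\<phi> t) = 0)"

lemma zero_branch_subset: "zero_branch q S \<phi> \<Longrightarrow> T \<subseteq> S \<Longrightarrow> zero_branch q T \<phi>"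
  unfolding zero_branch_def using holomorphic_on_subset by blast

text \<open>
  A holomorphic parametrisation of \<open>q\<close> that avoids the spectrum, so that all zeros that occur are simple.
\<close>

locale spectrum_free_parameter =
  fixes U :: "complex set" and q :: "complex \<Rightarrow> complex"
  assumes open_U: "open U" and q_holomorphic: "q holomorphic_on U"
    and norm_q: "t \<in> U \<Longrightarrow> norm (q t) < 1"
    and spectrum_free: "t \<in> U \<Longrightarrow> q t \<notin> partial_theta_spectrum"
begin


lemma local_branch:
  assumes "p \<in> U" "partial_theta (q p) a = 0"
  obtains \<eta> \<epsilon> \<phi> where "\<eta> > 0" "\<epsilon> > 0" "ball p \<eta> \<subseteq> U" "zero_branch q (ball p \<eta>) \<phi>"
    "\<And>t x. t \<in> ball p \<eta> \<Longrightarrow> x \<in> ball a \<epsilon> \<Longrightarrow> partial_theta (q t) x = 0 \<Longrightarrow> x = \<phi> t"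
proof -
  have 1: "deriv (partial_theta (q p)) a \<noteq> 0"
  proof
    assume "deriv (partial_theta (q p)) a = 0"
    moreover have "q p \<in> ball 0 1" unfolding mem_ball_0 by (rule norm_q[OF assms(1)])
    ultimately have "q p \<in> partial_theta_spectrum"
      using assms(2) unfolding partial_theta_spectrum_def by blast
    thus False using spectrum_free assms(1) by blast
  qed
  show ?thesis
  proof (rule local_zero_branch[OF open_U q_holomorphic norm_q assms 1])
    fix \<eta> \<epsilon> \<phi>
    assume "\<eta> > 0" "\<epsilon> > 0" "ball p \<eta> \<subseteq> U" "\<phi> holomorphic_on ball p \<eta>"
      "\<And>t. t \<in> ball p \<eta> \<Longrightarrow> partial_theta (q t) (\<phi> t) = 0"
      "\<And>t x. t \<in> ball p \<eta> \<Longrightarrow> x \<in> ball a \<epsilon> \<Longrightarrow> partial_theta (q t) x = 0 \<Longrightarrow> x = \<phi> t"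
    thus ?thesis
      by (intro that[of \<eta> \<epsilon> \<phi>]) (simp_all add: zero_branch_def)
  qed
qed

text \<open>
  Near \<open>c\<close> both branches are the local branch through their common value; the identity theorem does
  the rest.
\<close>

lemma zero_branch_unique:
  assumes S: "open S" "connected S" "S \<subseteq> U" and f: "zero_branch q S f" and g: "zero_branch q S g"
    and c: "c \<in> S" "f c = g c" and t: "t \<in> S"
  shows "f t = g t"
proof -
  have cU: "c \<in> U" "partial_theta (q c) (f c) = 0"
    using c(1) f S(3) by (auto simp: zero_branch_def)
  obtain \<eta> \<epsilon> \<phi> where loc: "\<eta> > 0" "\<epsilon> > 0" "ball c \<eta> \<subseteq> U" "zero_branch q (ball c \<eta>) \<phi>"
    "\<And>t x. t \<in> ball c \<eta> \<Longrightarrow> x \<in> ball (f c) \<epsilon> \<Longrightarrow> partial_theta (q t) x = 0 \<Longrightarrow> x = \<phi> t"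
    by (rule local_branch[OF cU]) (rule that)
  have hol: "f holomorphic_on S" "g holomorphic_on S"
    using f g by (auto simp: zero_branch_def)
  hence "isCont f c" "isCont g c"
    using S c holomorphic_on_imp_continuous_on continuous_on_eq_continuous_at by blast+
  then obtain d1 d2 where d: "d1 > 0" "d2 > 0"
    "\<And>t. dist t c < d1 \<Longrightarrow> dist (f t) (f c) < \<epsilon>" "\<And>t. dist t c < d2 \<Longrightarrow> dist (g t) (g c) < \<epsilon>"
    unfolding continuous_at_eps_delta using loc(2) by blast
  obtain d3 where d3: "d3 > 0" "ball c d3 \<subseteq> S" using S c open_contains_ball by blast
  define \<delta> where "\<delta> = Min {\<eta>, d1, d2, d3}"
  have \<delta>: "\<delta> > 0" using loc d d3 by (simp add: \<delta>_def)
  have "f u = g u" if u: "u \<in> ball c \<delta>" for u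
  proof -
    have u': "u \<in> ball c \<eta>" "u \<in> S" "dist u c < d1" "dist u c < d2"
      using u d3 by (auto simp: \<delta>_def dist_commute)
    have "f u \<in> ball (f c) \<epsilon>" "g u \<in> ball (f c) \<epsilon>"
      using d(3)[OF u'(3)] d(4)[OF u'(4)] c(2) by (simp_all add: dist_commute)
    moreover have "partial_theta (q u) (f u) = 0" "partial_theta (q u) (g u) = 0"
      using f g u'(2) by (simp_all add: zero_branch_def)
    ultimately have "f u = \<phi> u" "g u = \<phi> u"
      using loc(5)[OF u'(1)] by blast+
    thus ?thesis by simp
  qed
  moreover have "ball c \<delta> \<subseteq> S" using d3 by (auto simp: \<delta>_def)
  moreover have "ball c \<delta> \<noteq> {}" using \<delta> by simp
  ultimately show ?thesis
    using analytic_continuation_open[of "ball c \<delta>" S f g t] S hol t by blast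
qed

text \<open>
  The set of zeros of modulus at most \<open>M\<close> over a compact set of parameters is compact. So a
  Lebesgue number of the cover by neighbourhoods from \<open>local_branch\<close> is a radius that works for all of
  them.
\<close>

lemma uniform_local_branch:
  assumes K: "compact K" "K \<subseteq> U"
  obtains \<eta> where "\<eta> > 0"
    "\<And>p a. p \<in> K \<Longrightarrow> norm a \<le> M \<Longrightarrow> partial_theta (q p) a = 0 \<Longrightarrow>
       ball p \<eta> \<subseteq> U \<and> (\<exists>\<phi>. zero_branch q (ball p \<eta>) \<phi> \<and> \<phi> p = a)"
proof -
  define h where "h = (\<lambda>z. (\<lambda>(q, x). partial_theta q x) (q (fst z), snd z))"
  define Z where "Z = (K \<times> cball 0 M) \<inter> h -` {0}"
  have "continuous_on (K \<times> cball 0 M) h"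
    unfolding h_def
  proof (rule continuous_on_compose2[OF partial_theta_continuous])
    have cq: "continuous_on K q"
      using holomorphic_on_imp_continuous_on[OF q_holomorphic] K continuous_on_subset by blast
    show "continuous_on (K \<times> cball 0 M) (\<lambda>z. (q (fst z), snd z))"
      by (intro continuous_intros continuous_on_compose2[OF cq]) auto
    show "(\<lambda>z. (q (fst z), snd z)) ` (K \<times> cball 0 M) \<subseteq> ball 0 1 \<times> UNIV"
      using norm_q K by auto
  qed
  moreover have comp: "compact (K \<times> cball (0::complex) M)"
    using K by (intro compact_Times) auto
  ultimately have "closed Z"
    unfolding Z_def by (intro continuous_closed_preimage compact_imp_closed) auto
  hence "compact ((K \<times> cball 0 M) \<inter> Z)" by (rule compact_Int_closed[OF comp])
  moreover have "(K \<times> cball 0 M) \<inter> Z = Z" by (auto simp: Z_def)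
  ultimately have Zcomp: "compact Z" by (simp only:)
  define good where "good = (\<lambda>p \<eta> a \<epsilon> \<phi>. \<eta> > 0 \<and> \<epsilon> > 0 \<and> ball p \<eta> \<subseteq> U \<and> zero_branch q (ball p \<eta>) \<phi> \<and>
      (\<forall>t\<in>ball p \<eta>. \<forall>x\<in>ball a \<epsilon>. partial_theta (q t) x = 0 \<longrightarrow> x = \<phi> t))"
  define \<G> where "\<G> = {ball p \<eta> \<times> ball a \<epsilon> | p \<eta> a \<epsilon>. \<exists>\<phi>. good p \<eta> a \<epsilon> \<phi>}"
  have cover: "Z \<subseteq> \<Union>\<G>"
  proof
    fix z assume z: "z \<in> Z"
    obtain p a where pa: "z = (p, a)" by (cases z)
    have p: "p \<in> U" "partial_theta (q p) a = 0"
      using z K by (auto simp: Z_def h_def pa)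
    obtain \<eta> \<epsilon> \<phi> where "\<eta> > 0" "\<epsilon> > 0" "ball p \<eta> \<subseteq> U" "zero_branch q (ball p \<eta>) \<phi>"
      "\<And>t x. t \<in> ball p \<eta> \<Longrightarrow> x \<in> ball a \<epsilon> \<Longrightarrow> partial_theta (q t) x = 0 \<Longrightarrow> x = \<phi> t"
      by (rule local_branch[OF p]) (rule that)
    hence g: "good p \<eta> a \<epsilon> \<phi>" unfolding good_def by blast
    hence "ball p \<eta> \<times> ball a \<epsilon> \<in> \<G>" unfolding \<G>_def by blast
    moreover have "z \<in> ball p \<eta> \<times> ball a \<epsilon>" using g by (simp add: good_def pa)
    ultimately show "z \<in> \<Union>\<G>" by blast
  qed
  have opn: "open G" if "G \<in> \<G>" for G
    using that by (auto simp: \<G>_def intro!: open_Times)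
  obtain e where e: "e > 0" "\<And>z. z \<in> Z \<Longrightarrow> \<exists>G\<in>\<G>. ball z e \<subseteq> G"
    by (rule Heine_Borel_lemma[OF Zcomp cover opn]) (assumption, rule that)
  have "ball p e \<subseteq> U \<and> (\<exists>\<phi>. zero_branch q (ball p e) \<phi> \<and> \<phi> p = a)"
    if pa: "p \<in> K" "norm a \<le> M" "partial_theta (q p) a = 0" for p a
  proof -
    have "(p, a) \<in> Z" using pa by (simp add: Z_def h_def)
    then obtain G where "G \<in> \<G>" "ball (p, a) e \<subseteq> G" using e(2) by blast
    then obtain p' \<eta> a' \<epsilon> \<phi> where g: "ball (p, a) e \<subseteq> ball p' \<eta> \<times> ball a' \<epsilon>" "good p' \<eta> a' \<epsilon> \<phi>"
      unfolding \<G>_def by blast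
    have sub: "ball p e \<subseteq> ball p' \<eta>"
    proof
      fix t assume "t \<in> ball p e"
      hence "(t, a) \<in> ball (p, a) e" by (simp add: dist_Pair_Pair)
      thus "t \<in> ball p' \<eta>" using g(1) by blast
    qed
    have "(p, a) \<in> ball p' \<eta> \<times> ball a' \<epsilon>" using g(1) e(1) by (meson centre_in_ball subsetD)
    hence "a = \<phi> p" using g(2) pa(3) unfolding good_def by blast
    moreover have "ball p e \<subseteq> U" "zero_branch q (ball p e) \<phi>"
      using sub g(2) zero_branch_subset[OF _ sub] unfolding good_def by blast+
    ultimately show ?thesis by metis
  qed
  thus ?thesis using that e(1) by blast
qed

lemma zero_branch_norm_less:
  assumes S: "connected S" and \<phi>: "zero_branch q S \<phi>" and c: "c \<in> S" "norm (\<phi> c) < R c" and t: "t \<in> S"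
    and R: "continuous_on S R" "\<And>t x. t \<in> S \<Longrightarrow> norm x = R t \<Longrightarrow> partial_theta (q t) x \<noteq> 0"
  shows "norm (\<phi> t) < R t"
proof (rule ccontr)
  assume ge: "\<not> norm (\<phi> t) < R t"
  define h where "h = (\<lambda>t. norm (\<phi> t) - R t)"
  have "continuous_on S h"
    unfolding h_def using \<phi> R(1)
    by (intro continuous_intros holomorphic_on_imp_continuous_on) (auto simp: zero_branch_def)
  hence "connected (h ` S)" using S connected_continuous_image by blast
  moreover have "h c \<in> h ` S" "h t \<in> h ` S" using c t by auto
  moreover have "h c \<le> 0" "0 \<le> h t" using c ge by (auto simp: h_def)
  ultimately have "0 \<in> h ` S" by (rule connectedD_interval)
  then obtain u where "u \<in> S" "norm (\<phi> u) = R u" by (auto simp: h_def)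
  thus False using R(2) \<phi> by (auto simp: zero_branch_def)
qed

text \<open>
  A zero that cannot cross the moving circle \<open>|x| = R t\<close> stays bounded. Hence the radius \<open>\<eta>\<close> from
  \<open>uniform_local_branch\<close> does not shrink along the way, and the branch extends in finitely many steps
  from the disc of radius \<open>\<rho>\<close> to that of radius \<open>\<rho> + \<eta>\<close>. The local branches \<open>\<psi> p\<close> fit together
  because two overlapping discs of radius \<open>\<eta>\<close> centred in a disc share the midpoint of their centres,
  which lies in that disc too, where both agree with the branch already constructed.
\<close>

lemma disc_branch:
  assumes s: "s > 0" "cball c s \<subseteq> U"
    and R: "continuous_on (cball c s) R"
      "\<And>t x. t \<in> cball c s \<Longrightarrow> norm x = R t \<Longrightarrow> partial_theta (q t) x \<noteq> 0"
    and a: "partial_theta (q c) a = 0" "norm a < R c"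
  obtains \<phi> where "zero_branch q (ball c s) \<phi>" "\<phi> c = a"
proof -
  obtain t1 where t1: "\<And>t. t \<in> cball c s \<Longrightarrow> R t \<le> R t1"
    using continuous_attains_sup[OF compact_cball _ R(1)] s(1) by fastforce
  obtain \<eta> where \<eta>: "\<eta> > 0"
    "\<And>p a. p \<in> cball c s \<Longrightarrow> norm a \<le> R t1 \<Longrightarrow> partial_theta (q p) a = 0 \<Longrightarrow>
       ball p \<eta> \<subseteq> U \<and> (\<exists>\<phi>. zero_branch q (ball p \<eta>) \<phi> \<and> \<phi> p = a)"
    by (rule uniform_local_branch[OF compact_cball s(2), of "R t1"]) (rule that)
  have step: "\<exists>\<phi>. zero_branch q (ball c (min (real (Suc n) * \<eta>) s)) \<phi> \<and> \<phi> c = a" for n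
  proof (induction n)
    case 0
    have "norm a \<le> R t1" using a(2) t1[of c] s(1) by simp
    then obtain \<phi> where "zero_branch q (ball c \<eta>) \<phi>" "\<phi> c = a"
      using \<eta>(2)[of c a] a(1) s(1) by auto
    moreover from this(1) have "zero_branch q (ball c (min (real (Suc 0) * \<eta>) s)) \<phi>"
      by (rule zero_branch_subset) auto
    ultimately show ?case by blast
  next
    case (Suc n)
    define \<rho> where "\<rho> = min (real (Suc n) * \<eta>) s"
    have \<rho>: "\<rho> > 0" "\<rho> \<le> s" using \<eta> s by (auto simp: \<rho>_def)
    have subs: "ball c \<rho> \<subseteq> cball c s" using \<rho> by auto
    obtain \<phi> where \<phi>: "zero_branch q (ball c \<rho>) \<phi>" "\<phi> c = a"
      using Suc.IH unfolding \<rho>_def by blast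
    have ex: "\<exists>\<psi>. zero_branch q (ball p \<eta>) \<psi> \<and> \<psi> p = \<phi> p" and ballU: "ball p \<eta> \<subseteq> U"
      if p: "p \<in> ball c \<rho>" for p
    proof -
      have "norm (\<phi> p) < R p"
        by (rule zero_branch_norm_less[OF _ \<phi>(1) _ _ p])
           (use \<rho> \<phi>(2) a(2) R subs in \<open>auto intro: continuous_on_subset\<close>)
      moreover have "R p \<le> R t1" using t1 p subs by blast
      moreover have "partial_theta (q p) (\<phi> p) = 0" using \<phi>(1) p by (auto simp: zero_branch_def)
      moreover have "p \<in> cball c s" using p subs by blast
      ultimately have "ball p \<eta> \<subseteq> U \<and> (\<exists>\<psi>. zero_branch q (ball p \<eta>) \<psi> \<and> \<psi> p = \<phi> p)"
        by (intro \<eta>(2)) auto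
      thus "\<exists>\<psi>. zero_branch q (ball p \<eta>) \<psi> \<and> \<psi> p = \<phi> p" "ball p \<eta> \<subseteq> U" by blast+
    qed
    then obtain \<psi> where \<psi>: "\<And>p. p \<in> ball c \<rho> \<Longrightarrow> zero_branch q (ball p \<eta>) (\<psi> p)"
      "\<And>p. p \<in> ball c \<rho> \<Longrightarrow> \<psi> p p = \<phi> p"
      using bchoice[of "ball c \<rho>" "\<lambda>p \<psi>. zero_branch q (ball p \<eta>) \<psi> \<and> \<psi> p = \<phi> p"] by blast
    have agree: "\<psi> p u = \<phi> u" if p: "p \<in> ball c \<rho>" and u: "u \<in> ball p \<eta>" "u \<in> ball c \<rho>" for p u
    proof (rule zero_branch_unique[of "ball p \<eta> \<inter> ball c \<rho>" "\<psi> p" \<phi> p u])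
      show "zero_branch q (ball p \<eta> \<inter> ball c \<rho>) (\<psi> p)" "zero_branch q (ball p \<eta> \<inter> ball c \<rho>) \<phi>"
        using zero_branch_subset[OF \<psi>(1)[OF p]] zero_branch_subset[OF \<phi>(1)] by auto
      show "connected (ball p \<eta> \<inter> ball c \<rho>)"
        by (intro convex_connected convex_Int convex_ball)
      show "ball p \<eta> \<inter> ball c \<rho> \<subseteq> U" using ballU[OF p] by blast
      show "\<psi> p p = \<phi> p" by (rule \<psi>(2)[OF p])
    qed (use p u \<eta>(1) in auto)
    have consistent: "\<psi> p t = \<psi> p' t"
      if p: "p \<in> ball c \<rho>" "p' \<in> ball c \<rho>" and t: "t \<in> ball p \<eta>" "t \<in> ball p' \<eta>" for p p' t
    proof -
      define \<mu> where "\<mu> = midpoint p p'"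
      have "dist p p' \<le> dist p t + dist p' t" by (rule dist_triangle2)
      hence "dist p p' < 2 * \<eta>" using t by simp
      hence \<mu>: "\<mu> \<in> ball p \<eta>" "\<mu> \<in> ball p' \<eta>"
        by (auto simp: \<mu>_def dist_midpoint)
      have "closed_segment p p' \<subseteq> ball c \<rho>"
        using p by (simp add: closed_segment_subset)
      hence "\<mu> \<in> ball c \<rho>" unfolding \<mu>_def using midpoint_in_closed_segment by blast
      hence eq: "\<psi> p \<mu> = \<psi> p' \<mu>" using agree p \<mu> by simp
      show ?thesis
      proof (rule zero_branch_unique[of "ball p \<eta> \<inter> ball p' \<eta>" "\<psi> p" "\<psi> p'" \<mu> t])
        show "zero_branch q (ball p \<eta> \<inter> ball p' \<eta>) (\<psi> p)" "zero_branch q (ball p \<eta> \<inter> ball p' \<eta>) (\<psi> p')"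
          using zero_branch_subset[OF \<psi>(1)[OF p(1)]] zero_branch_subset[OF \<psi>(1)[OF p(2)]] by auto
        show "connected (ball p \<eta> \<inter> ball p' \<eta>)"
          by (intro convex_connected convex_Int convex_ball)
        show "ball p \<eta> \<inter> ball p' \<eta> \<subseteq> U" using ballU[OF p(1)] by blast
      qed (use t \<mu> eq in auto)
    qed
    \<comment> \<open>The value at \<open>t\<close> is that of any local branch whose disc contains \<open>t\<close>.\<close>
    define P where "P = (\<lambda>t. SOME p. p \<in> ball c \<rho> \<and> t \<in> ball p \<eta>)"
    define \<Phi> where "\<Phi> = (\<lambda>t. \<psi> (P t) t)"
    have \<Phi>: "\<Phi> t = \<psi> p t" if "p \<in> ball c \<rho>" "t \<in> ball p \<eta>" for p t
    proof -
      have "P t \<in> ball c \<rho> \<and> t \<in> ball (P t) \<eta>"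
        unfolding P_def by (rule someI[of _ p]) (use that in blast)
      thus ?thesis unfolding \<Phi>_def using consistent[of "P t" p t] that by blast
    qed
    have br: "zero_branch q (\<Union>p\<in>ball c \<rho>. ball p \<eta>) \<Phi>"
      unfolding zero_branch_def
    proof
      have "\<Phi> holomorphic_on ball p \<eta>" if "p \<in> ball c \<rho>" for p
      proof (rule holomorphic_transform[of "\<psi> p"])
        show "\<psi> p holomorphic_on ball p \<eta>" using \<psi>(1)[OF that] unfolding zero_branch_def by blast
        show "\<psi> p t = \<Phi> t" if "t \<in> ball p \<eta>" for t
          using \<Phi>[OF \<open>p \<in> ball c \<rho>\<close> that] by (rule sym)
      qed
      thus "\<Phi> holomorphic_on (\<Union>p\<in>ball c \<rho>. ball p \<eta>)"
        by (rule holomorphic_on_UN_open) (assumption, rule open_ball)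
      show "\<forall>t\<in>(\<Union>p\<in>ball c \<rho>. ball p \<eta>). partial_theta (q t) (\<Phi> t) = 0"
      proof
        fix t assume "t \<in> (\<Union>p\<in>ball c \<rho>. ball p \<eta>)"
        then obtain p where "p \<in> ball c \<rho>" "t \<in> ball p \<eta>" by blast
        thus "partial_theta (q t) (\<Phi> t) = 0"
          using \<psi>(1)[of p] \<Phi>[of p t] by (simp add: zero_branch_def)
      qed
    qed
    have "ball c (min (real (Suc (Suc n)) * \<eta>) s) \<subseteq> (\<Union>p\<in>ball c \<rho>. ball p \<eta>)"
    proof
      fix t assume "t \<in> ball c (min (real (Suc (Suc n)) * \<eta>) s)"
      hence t: "dist c t < \<rho> + \<eta>" using \<eta> by (auto simp: \<rho>_def algebra_simps)
      \<comment> \<open>This division of the segment from \<open>c\<close> to \<open>t\<close> puts \<open>p\<close> within \<open>\<rho>\<close> of \<open>c\<close> and within \<open>\<eta>\<close> of \<open>t\<close>.\<close>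
      define l where "l = \<rho> / (\<rho> + \<eta>)"
      define p where "p = c + of_real l * (t - c)"
      have l: "0 < l" "l < 1" using \<rho> \<eta> by (auto simp: l_def)
      have "dist c p = l * dist c t"
        using l by (simp add: p_def dist_norm norm_mult norm_minus_commute)
      also have "\<dots> < l * (\<rho> + \<eta>)" using t l by simp
      also have "\<dots> = \<rho>" using \<rho> \<eta> by (simp add: l_def)
      finally have 1: "p \<in> ball c \<rho>" by simp
      have "t - p = of_real (1 - l) * (t - c)" by (simp add: p_def algebra_simps)
      hence "norm (t - p) = (1 - l) * norm (t - c)"
        using l by (simp add: norm_mult del: of_real_diff)
      hence "dist p t = (1 - l) * dist c t"
        by (simp only: dist_norm norm_minus_commute[of p t] norm_minus_commute[of c t])
      also have "\<dots> < (1 - l) * (\<rho> + \<eta>)" using t l by simp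
      also have "\<dots> = \<eta>" using \<rho> \<eta> by (simp add: l_def field_simps)
      finally have "t \<in> ball p \<eta>" by simp
      thus "t \<in> (\<Union>p\<in>ball c \<rho>. ball p \<eta>)" using 1 by blast
    qed
    hence "zero_branch q (ball c (min (real (Suc (Suc n)) * \<eta>) s)) \<Phi>"
      by (rule zero_branch_subset[OF br])
    moreover have "\<Phi> c = a" using \<Phi>[of c c] \<psi>(2)[of c] \<phi>(2) \<rho>(1) \<eta>(1) by simp
    ultimately show ?case by blast
  qed
  obtain n where "s / \<eta> < real n" using reals_Archimedean2 by blast
  hence "s \<le> real (Suc n) * \<eta>" using \<eta>(1) by (simp add: field_simps)
  hence "min (real (Suc n) * \<eta>) s = s" by simp
  with step[of n] show ?thesis using that by metis
qed

end

section \<open>Zeros of large modulus\<close>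

text \<open>
  On these circles \<open>y = x q^k\<close> has modulus \<open>|q|^(-1/2)\<close>, halfway between two zeros of \<open>J\<close>. There
  \<open>|J(q, y)|\<close> has a positive lower bound depending only on \<open>r1\<close>, while the perturbation in
  \<open>partial_theta_shift_zero_iff\<close> is at most \<open>2 r1^k\<close>.
\<close>

lemma partial_theta_nonzero_on_circles:
  assumes r1: "0 \<le> r1" "r1 < 1"
  obtains k0 where "\<And>k q x. k0 \<le> k \<Longrightarrow> q \<noteq> 0 \<Longrightarrow> norm q \<le> r1 \<Longrightarrow>
     norm x = 1 / (sqrt (norm q) * norm q ^ k) \<Longrightarrow> partial_theta q x \<noteq> 0"
proof -
  define s1 where "s1 = sqrt r1"
  have s1: "0 \<le> s1" "s1 < 1" using r1 by (auto simp: s1_def)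
  define c1 where "c1 = (1 - s1) * exp (- 6 / (1 - s1))"
  have c1: "c1 > 0" using s1 by (simp add: c1_def)
  have lim: "(\<lambda>k. r1 ^ k) \<longlonglongrightarrow> 0" using r1 by (intro LIMSEQ_realpow_zero) auto
  have "\<forall>\<^sub>F k in sequentially. r1 ^ k < min (c1 / 2) (1 / 2)"
    using c1 by (intro order_tendstoD(2)[OF lim]) auto
  then obtain k0 where k0: "\<And>k. k \<ge> k0 \<Longrightarrow> r1 ^ k < min (c1 / 2) (1 / 2)"
    by (auto simp: eventually_at_top_linorder)
  show ?thesis
  proof (rule that[of k0])
    fix k :: nat and q x :: complex
    assume k: "k0 \<le> k" and q: "q \<noteq> 0" "norm q \<le> r1"
      and x: "norm x = 1 / (sqrt (norm q) * norm q ^ k)"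
    define s where "s = sqrt (norm q)"
    define y where "y = x * q ^ k"
    have q1: "norm q < 1" using q r1 by simp
    have s: "0 < s" "s < 1" "s \<le> s1" using q q1 by (auto simp: s_def s1_def)
    have ny: "norm y = 1 / s" using q x by (simp add: y_def s_def norm_mult norm_power)
    have y0: "y \<noteq> 0" using ny s by auto
    have xy: "x = y / q ^ k" using q by (simp add: y_def)
    have s1y: "1 \<le> norm y" using s by (simp add: ny)
    have rk: "norm q ^ k \<le> r1 ^ k" using q by (intro power_mono) auto
    have "c1 \<le> norm (1 + 1 / y) * exp (- 6 / (1 - s))"
      unfolding c1_def
    proof (intro mult_mono)
      have "1 \<le> norm (1 + 1 / y) + norm (1 / y)"
        using norm_triangle_ineq4[of "1 + 1 / y" "1 / y"] by simp
      thus "1 - s1 \<le> norm (1 + 1 / y)"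
        using s ny by (simp add: norm_divide)
      have "6 / (1 - s) \<le> 6 / (1 - s1)" using s s1 by (intro divide_left_mono) auto
      thus "exp (- 6 / (1 - s1)) \<le> exp (- 6 / (1 - s))" by simp
    qed auto
    also have "\<dots> \<le> norm (jacobi_theta q y)"
    proof (rule jacobi_theta_lower_bound[OF q1 q(1) s_def])
      show "s \<le> norm y" using s s1y by linarith
      show "norm y * s \<le> 1" using s by (simp add: ny)
    qed
    finally have lower: "c1 \<le> norm (jacobi_theta q y)" .
    have inv: "norm (1 / y) \<le> 1" using s1y y0 by (simp add: norm_divide divide_simps)
    have "norm (q ^ k / y) = norm q ^ k * norm (1 / y)" by (simp add: norm_divide norm_power)
    also have "\<dots> \<le> r1 ^ k * 1" using rk inv r1 by (intro mult_mono) auto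
    finally have "norm (q ^ k / y) \<le> 1 / 2" using k0[OF k] by simp
    hence T: "norm (partial_theta q (q ^ k / y)) \<le> 2"
      by (intro norm_partial_theta_le_2 q1)
    have "k \<le> tri k" by (cases k) (auto simp: tri_Suc)
    hence "norm q ^ tri k \<le> norm q ^ k" using q1 by (intro power_decreasing) auto
    hence Q: "norm q ^ tri k \<le> r1 ^ k" using rk by linarith
    have "q ^ tri k / y ^ Suc k * partial_theta q (q ^ k / y) =
          q ^ tri k * (1 / y) ^ Suc k * partial_theta q (q ^ k / y)"
      by (simp add: power_one_over field_simps)
    also have "norm \<dots> \<le> r1 ^ k * 1 * 2"
      unfolding norm_mult norm_power
      using Q T inv r1 by (intro mult_mono power_le_one mult_nonneg_nonneg) auto
    also have "\<dots> < c1" using k0[OF k] by simp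
    finally have "jacobi_theta q y \<noteq> q ^ tri k / y ^ Suc k * partial_theta q (q ^ k / y)"
      using lower by auto
    thus "partial_theta q x \<noteq> 0"
      unfolding xy using partial_theta_shift_zero_iff[OF q1 q(1) y0, of k] by simp
  qed
qed

lemma jacobi_theta_minus_one [simp]: "jacobi_theta q (- 1) = 0"
  by (simp add: jacobi_theta_def)

lemma exp_over_half_gap:
  fixes u :: real
  assumes "u > 0"
  shows "1 / (1 - exp (- u)) \<le> 1 + 1 / u"
proof -
  have "exp (- u) * (1 + u) \<le> exp (- u) * exp u"
    using exp_ge_add_one_self[of u] by (intro mult_left_mono) (auto simp: add.commute)
  hence "u \<le> (1 - exp (- u)) * (1 + u)" by (simp add: algebra_simps flip: exp_add)
  moreover have "exp (- u) < 1" using assms by simp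
  ultimately show ?thesis using assms by (simp add: field_simps)
qed

text \<open>
  Both sides of the equation in \<open>partial_theta_shift_zero_iff\<close> for \<open>k = n\<close>, on the disc of radius \<open>1/n\<close>
  around \<open>-1\<close>. The perturbation is about \<open>|q|^(n^2/2) = exp(- \<tau> n/2) \<le> exp(- 3n)\<close>. The lower bound for
  \<open>J\<close> on the boundary is about \<open>exp(- 12n/\<tau>)/(2n) \<ge> exp(- 2n)/(2n)\<close>. The first is smaller because \<open>\<tau>\<close>
  is at least \<open>6\<close>; the assumption on \<open>exp n\<close> absorbs the remaining constants.
\<close>

lemma outer_zero_estimates:
  fixes n :: nat and \<tau> :: real
  assumes n: "n \<ge> 2" "exp (real n) > 8 * real n * exp 9"
    and \<tau>: "6 \<le> \<tau>" "\<tau> \<le> 7"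
    and q: "norm q = exp (- \<tau> / real n)"
    and y: "norm (y + 1) \<le> 1 / real n"
  shows "norm (q ^ tri n / y ^ Suc n * partial_theta q (q ^ n / y)) \<le> 2 * exp (- 3 * (real n - 1))"
    and "norm (y + 1) = 1 / real n \<Longrightarrow> norm (jacobi_theta q y) > 4 * exp (- 3 * (real n - 1))"
    and "y \<noteq> 0"
proof -
  have n0: "real n \<ge> 2" using n(1) by simp
  have q1: "norm q < 1" using q \<tau> n0 by simp
  have q0: "q \<noteq> 0" using q by auto
  \<comment> \<open>Here \<open>exp (- u)\<close> is the square root of \<open>|q|\<close>, the inner radius of the annulus of the lower bound.\<close>
  define u where "u = \<tau> / (2 * real n)"
  define s where "s = exp (- u)"
  have u: "u \<ge> 3 / real n" using \<tau> n0 by (simp add: u_def divide_simps)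
  have u0: "u > 0" using \<tau> n0 by (simp add: u_def)
  have ssq: "s = sqrt (norm q)"
  proof -
    have "norm q = s ^ 2" by (simp add: q s_def u_def flip: exp_double)
    thus ?thesis by (simp add: s_def)
  qed
  have "1 \<le> norm y + norm (y + 1)" "norm y \<le> norm (y + 1) + 1"
    using norm_triangle_ineq4[of "y + 1" y] norm_triangle_ineq4[of "y + 1" 1] by simp_all
  hence ny: "1 - 1 / real n \<le> norm y" "norm y \<le> 1 + 1 / real n" using y by auto
  have n_half: "1 / real n \<le> 1 / 2" using n0 by (simp add: divide_simps)
  have nyh: "1 / 2 \<le> norm y" "norm y \<le> 2" using ny n_half by auto
  show y0: "y \<noteq> 0" using nyh by auto
  have es: "exp (3 / real n) \<le> exp u" using u by simp
  have e3: "1 + 3 / real n \<le> exp u" using exp_ge_add_one_self[of "3 / real n"] es by linarith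
  have sy1: "norm y * s \<le> 1"
  proof -
    have "norm y \<le> exp u" using ny(2) e3 n0 by (smt (verit) divide_right_mono of_nat_0_le_iff)
    thus ?thesis by (simp add: s_def exp_minus field_simps)
  qed
  have sy2: "s \<le> norm y"
  proof -
    have "1 \<le> (1 - 1 / real n) * (1 + 3 / real n)" using n0 by (simp add: field_simps)
    also have "\<dots> \<le> norm y * exp u" using ny(1) e3 n_half by (intro mult_mono) auto
    finally show ?thesis by (simp add: s_def exp_minus field_simps)
  qed
  show "norm (q ^ tri n / y ^ Suc n * partial_theta q (q ^ n / y)) \<le> 2 * exp (- 3 * (real n - 1))"
  proof -
    have "norm (q ^ n) = exp (- \<tau>)" using n0 by (simp add: norm_power q flip: exp_of_nat_mult)
    also have "\<dots> \<le> exp (- 6)" using \<tau> by simp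
    also have "\<dots> \<le> 1 / 4"
    proof -
      have "(4::real) \<le> exp 6" using exp_ge_add_one_self[of 6] by simp
      thus ?thesis by (simp add: exp_minus field_simps)
    qed
    finally have "norm (q ^ n) \<le> 1 / 4" .
    hence "norm (q ^ n / y) \<le> 1 / 2" using nyh y0 by (simp add: norm_divide divide_simps)
    hence T: "norm (partial_theta q (q ^ n / y)) \<le> 2" by (intro norm_partial_theta_le_2 q1)
    have "norm (1 / y) \<le> exp u" using sy2 y0 by (simp add: norm_divide s_def exp_minus field_simps)
    hence Y: "norm (1 / y) ^ Suc n \<le> exp u ^ Suc n" by (intro power_mono) auto
    have "norm q ^ tri n * exp u ^ Suc n = exp (- (\<tau> / real n) * real (tri n) + u * real (Suc n))"
      by (simp only: q exp_add minus_divide_left flip: exp_of_nat_mult) (simp add: mult_ac)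
    also have "real (tri n) = real n * (real n + 1) / 2"
      using arg_cong[OF double_tri[of n], of real] by (simp add: algebra_simps)
    also have "- (\<tau> / real n) * (real n * (real n + 1) / 2) + u * real (Suc n) =
               - \<tau> / 2 * (real n - 1 / real n)"
      using n0 by (simp add: u_def field_simps)
    also have "\<dots> \<le> - 3 * (real n - 1)"
    proof -
      have "3 * (real n - 1) \<le> \<tau> / 2 * (real n - 1 / real n)"
        using \<tau> n0 n_half by (intro mult_mono) auto
      moreover have "- \<tau> / 2 * (real n - 1 / real n) = - (\<tau> / 2 * (real n - 1 / real n))" by simp
      ultimately show ?thesis by linarith
    qed
    finally have E: "norm q ^ tri n * exp u ^ Suc n \<le> exp (- 3 * (real n - 1))" by simp
    have "q ^ tri n / y ^ Suc n * partial_theta q (q ^ n / y) =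
          q ^ tri n * (1 / y) ^ Suc n * partial_theta q (q ^ n / y)"
      by (simp add: power_one_over field_simps)
    also have "norm \<dots> \<le> norm q ^ tri n * exp u ^ Suc n * 2"
      unfolding norm_mult norm_power using T Y
      by (intro mult_mono mult_nonneg_nonneg) auto
    also have "\<dots> \<le> exp (- 3 * (real n - 1)) * 2" using E by simp
    finally show ?thesis by simp
  qed
  show "norm (jacobi_theta q y) > 4 * exp (- 3 * (real n - 1))" if eq: "norm (y + 1) = 1 / real n"
  proof -
    have "1 / (1 - s) \<le> 1 + 1 / u" unfolding s_def by (rule exp_over_half_gap[OF u0])
    also have "1 / u \<le> real n / 3" using u u0 n0 by (simp add: field_simps)
    finally have "- 6 - 2 * real n \<le> - 6 / (1 - s)" by simp
    hence E: "exp (- 6 - 2 * real n) \<le> exp (- 6 / (1 - s))" by simp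
    have "1 + 1 / y = (y + 1) / y" using y0 by (simp add: field_simps)
    hence "norm (1 + 1 / y) = 1 / real n / norm y" by (simp add: norm_divide eq)
    also have "\<dots> \<ge> 1 / real n / 2" using nyh y0 n0 by (intro divide_left_mono) auto
    finally have Y: "1 / (2 * real n) \<le> norm (1 + 1 / y)" by simp
    have split: "exp (9 + a - b) = exp 9 * exp a / exp b" for a b :: real
      by (simp add: exp_add exp_diff)
    have "- 3 * (real n - 1) = 9 + (- 6 - 2 * real n) - real n" by simp
    hence "4 * exp (- 3 * (real n - 1)) = 4 * exp 9 * exp (- 6 - 2 * real n) / exp (real n)"
      by (simp only: split)
    also have "\<dots> < 1 / (2 * real n) * exp (- 6 - 2 * real n)"
    proof -
      have "4 * exp 9 / exp (real n) < 1 / (2 * real n)"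
        using n(2) n0 by (simp add: field_simps)
      from mult_strict_right_mono[OF this exp_gt_zero[of "- 6 - 2 * real n"]] show ?thesis
        by (simp add: mult_ac)
    qed
    also have "\<dots> \<le> norm (1 + 1 / y) * exp (- 6 / (1 - s))"
      using Y E n0 by (intro mult_mono) auto
    also have "\<dots> \<le> norm (jacobi_theta q y)"
      by (rule jacobi_theta_lower_bound[OF q1 q0 ssq sy2 sy1])
    finally show ?thesis .
  qed
qed

lemma jacobi_theta_holomorphic:
  assumes "norm q < 1" "open S" "0 \<notin> S"
  shows "jacobi_theta q holomorphic_on S"
proof -
  have "(\<lambda>y. partial_theta q (1 / y)) holomorphic_on S"
    using assms by (intro partial_theta_comp_holomorphic holomorphic_intros) auto
  moreover have "partial_theta q holomorphic_on S" by (rule partial_theta_holomorphic[OF assms(1)])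
  ultimately have "(\<lambda>y. partial_theta q y + partial_theta q (1 / y) / y) holomorphic_on S"
    using assms by (intro holomorphic_intros) auto
  thus ?thesis by (simp add: jacobi_theta_def[abs_def])
qed

text \<open>
  The difference \<open>J - e\<close>, where \<open>e\<close> is the perturbation, is larger on the boundary of the disc around
  \<open>-1\<close> than at its centre, where \<open>J\<close> vanishes. So it has a zero inside by the minimum modulus
  principle, and none on the boundary.
\<close>

lemma outer_zero:
  fixes n :: nat and \<tau> :: real
  assumes n: "n \<ge> 2" "exp (real n) > 8 * real n * exp 9"
    and \<tau>: "6 \<le> \<tau>" "\<tau> \<le> 7"
    and q: "norm q = exp (- \<tau> / real n)" "q ^ n = exp (- of_real \<tau>)"
  shows "norm (y + 1) = 1 / real n \<Longrightarrow> partial_theta q (exp (of_real \<tau>) * y) \<noteq> 0"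
    and "\<exists>y. norm (y + 1) < 1 / real n \<and> partial_theta q (exp (of_real \<tau>) * y) = 0"
proof -
  have n0: "real n \<ge> 2" using n(1) by simp
  have q1: "norm q < 1" using q \<tau> n0 by simp
  have q0: "q \<noteq> 0" using q(1) by auto
  define e where "e = (\<lambda>y. q ^ tri n / y ^ Suc n * partial_theta q (q ^ n / y))"
  have iff: "partial_theta q (exp (of_real \<tau>) * y) = 0 \<longleftrightarrow> jacobi_theta q y - e y = 0" if "y \<noteq> 0" for y
  proof -
    have "exp (of_real \<tau>) * y = y / q ^ n" by (simp add: q(2) exp_minus field_simps)
    thus ?thesis using partial_theta_shift_zero_iff[OF q1 q0 that, of n] by (simp add: e_def)
  qed
  note est = outer_zero_estimates[OF n \<tau> q(1)]
  have gap: "norm (jacobi_theta q y - e y) > 2 * exp (- 3 * (real n - 1))"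
    if "norm (y + 1) = 1 / real n" for y
  proof -
    have "norm (jacobi_theta q y) - norm (e y) \<le> norm (jacobi_theta q y - e y)"
      by (rule norm_triangle_ineq2)
    thus ?thesis using est(1)[of y] est(2)[of y] that by (simp add: e_def)
  qed
  show "partial_theta q (exp (of_real \<tau>) * y) \<noteq> 0" if y: "norm (y + 1) = 1 / real n" for y
  proof -
    have "y \<noteq> 0" using est(3)[of y] y by simp
    moreover have "0 < norm (jacobi_theta q y - e y)"
      using gap[OF y] exp_gt_zero[of "- 3 * (real n - 1)"] by linarith
    ultimately show ?thesis using iff[of y] by simp
  qed
  have S: "0 \<notin> ball (-1::complex) 1" by simp
  have hol: "(\<lambda>y. jacobi_theta q y - e y) holomorphic_on ball (-1) 1"
  proof -
    have "(\<lambda>y. partial_theta q (q ^ n / y)) holomorphic_on ball (-1) 1"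
      using S q1 by (intro partial_theta_comp_holomorphic holomorphic_intros) auto
    thus ?thesis unfolding e_def
      by (intro holomorphic_intros jacobi_theta_holomorphic q1 open_ball S) auto
  qed
  have sub: "cball (-1::complex) (1 / real n) \<subseteq> ball (-1) 1"
  proof
    fix y :: complex assume "y \<in> cball (-1) (1 / real n)"
    moreover have "1 / real n < 1" using n0 by simp
    ultimately show "y \<in> ball (-1) 1" by simp
  qed
  obtain y where y: "y \<in> ball (-1) (1 / real n)" "jacobi_theta q y - e y = 0"
  proof (rule holomorphic_contract_to_zero[of "-1" "1 / real n" "\<lambda>y. jacobi_theta q y - e y"])
    show "continuous_on (cball (-1) (1 / real n)) (\<lambda>y. jacobi_theta q y - e y)"
      by (rule holomorphic_on_imp_continuous_on[OF holomorphic_on_subset[OF hol sub]])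
    show "(\<lambda>y. jacobi_theta q y - e y) holomorphic_on ball (-1) (1 / real n)"
      using sub by (intro holomorphic_on_subset[OF hol]) auto
    show "0 < 1 / real n" using n0 by simp
    fix z :: complex assume "norm (- 1 - z) = 1 / real n"
    hence "norm (z + 1) = 1 / real n" using norm_minus_commute[of "-1" z] by simp
    from gap[OF this] show "norm (jacobi_theta q (-1) - e (-1)) < norm (jacobi_theta q z - e z)"
      using est(1)[of "-1"] n0 by (simp add: e_def)
  qed (rule that)
  have "norm (y + 1) < 1 / real n"
    using y(1) by (simp add: dist_norm norm_minus_commute[of "-1" y])
  moreover from this have "partial_theta q (exp (of_real \<tau>) * y) = 0"
    using iff[of y] est(3)[of y] y(2) by simp
  ultimately show "\<exists>y. norm (y + 1) < 1 / real n \<and> partial_theta q (exp (of_real \<tau>) * y) = 0" by blast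
qed

section \<open>Limits at roots of unity of odd order\<close>

text \<open>
  Writing the index as \<open>nm + r\<close>, its triangular number is \<open>m^2 tri n + m (r - h) n + tri r\<close>; here \<open>m\<close>
  is odd so that \<open>h = (m - 1)/2\<close> is an integer. If \<open>q^m\<close> is real, each residue class thus contributes a
  partial theta function with the real parameter \<open>q^(m^2)\<close>.
\<close>

lemma partial_theta_dissection:
  assumes q: "norm q < 1" "q \<noteq> 0" and m: "m = 2 * h + 1"
  shows "partial_theta q x = (\<Sum>r<m. q ^ tri r * x ^ r *
           partial_theta (q ^ (m * m)) (x ^ m * q ^ (m * r) / q ^ (m * h)))"
proof -
  define X where "X = (\<lambda>r. x ^ m * q ^ (m * r) / q ^ (m * h))"
  have m0: "m > 0" using m by simp
  have Q: "norm (q ^ (m * m)) < 1"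
    using q m0 by (simp add: norm_power power_less_one_iff)
  have "(\<lambda>j. q ^ tri j * x ^ j) sums partial_theta q x"
    unfolding partial_theta_tri using summable_partial_theta[OF q(1)] by (rule summable_sums)
  hence "(\<lambda>n. \<Sum>j = n * m..<n * m + m. q ^ tri j * x ^ j) sums partial_theta q x"
    using m0 by (rule sums_group)
  also have "(\<lambda>n. \<Sum>j = n * m..<n * m + m. q ^ tri j * x ^ j) =
             (\<lambda>n. \<Sum>r<m. q ^ tri r * x ^ r * ((q ^ (m * m)) ^ tri n * X r ^ n))"
  proof
    fix n
    have "(\<Sum>j = n * m..<n * m + m. q ^ tri j * x ^ j) =
          (\<Sum>r<m. q ^ tri (n * m + r) * x ^ (n * m + r))"
      using sum.shift_bounds_nat_ivl[of "\<lambda>j. q ^ tri j * x ^ j" 0 "n * m" m]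
      by (simp add: lessThan_atLeast0 add.commute)
    also have "\<dots> = (\<Sum>r<m. q ^ tri r * x ^ r * ((q ^ (m * m)) ^ tri n * X r ^ n))"
    proof (rule sum.cong)
      fix r
      have "2 * (tri (n * m + r) + m * h * n) = 2 * tri (n * m + r) + 2 * (m * h * n)" by simp
      also have "\<dots> = m * m * (n * (n + 1)) + 2 * (m * r * n) + r * (r + 1)"
        unfolding double_tri by (simp add: m algebra_simps)
      also have "\<dots> = m * m * (2 * tri n) + 2 * (m * r * n) + 2 * tri r"
        by (simp only: double_tri)
      finally have "2 * (tri (n * m + r) + m * h * n) = 2 * (m * m * tri n + m * r * n + tri r)"
        by simp
      hence "tri (n * m + r) + m * h * n = m * m * tri n + m * r * n + tri r"
        unfolding mult_cancel1 by simp
      hence "q ^ (tri (n * m + r) + m * h * n) = q ^ (m * m * tri n + m * r * n + tri r)"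
        by (rule arg_cong)
      hence "q ^ tri (n * m + r) * (q ^ (m * h)) ^ n = (q ^ (m * m)) ^ tri n * (q ^ (m * r)) ^ n * q ^ tri r"
        by (simp only: power_add power_mult)
      hence eq: "q ^ tri (n * m + r) = (q ^ (m * m)) ^ tri n * (q ^ (m * r)) ^ n * q ^ tri r / (q ^ (m * h)) ^ n"
        using q by (simp add: field_simps)
      have "x ^ (n * m + r) = (x ^ m) ^ n * x ^ r"
        by (simp add: power_add power_mult mult.commute)
      thus "q ^ tri (n * m + r) * x ^ (n * m + r) = q ^ tri r * x ^ r * ((q ^ (m * m)) ^ tri n * X r ^ n)"
        unfolding eq by (simp add: X_def power_mult_distrib power_divide mult_ac)
    qed simp
    finally show "(\<Sum>j = n * m..<n * m + m. q ^ tri j * x ^ j) =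
             (\<Sum>r<m. q ^ tri r * x ^ r * ((q ^ (m * m)) ^ tri n * X r ^ n))" .
  qed
  finally have 1: "(\<lambda>n. \<Sum>r<m. q ^ tri r * x ^ r * ((q ^ (m * m)) ^ tri n * X r ^ n)) sums partial_theta q x" .
  have "(\<lambda>n. \<Sum>r<m. q ^ tri r * x ^ r * ((q ^ (m * m)) ^ tri n * X r ^ n)) sums
         (\<Sum>r<m. q ^ tri r * x ^ r * partial_theta (q ^ (m * m)) (X r))"
    unfolding partial_theta_tri
    by (intro sums_sum sums_mult summable_sums summable_partial_theta Q)
  from sums_unique2[OF 1 this] show ?thesis by (simp add: X_def)
qed

text \<open>
  Every summand of the dissection falls under \<open>partial_theta_tendsto_outside\<close> with the same limit
  point \<open>X0 = (- exp \<tau>)^m = - exp (m \<tau>)\<close>; the minus sign survives because \<open>m\<close> is odd, and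
  \<open>m \<tau> < ln 2\<close> keeps \<open>X0\<close> in the region where that lemma applies.
\<close>

lemma partial_theta_tendsto_at_root_of_unity:
  fixes \<zeta> :: complex and \<rho> :: "nat \<Rightarrow> real" and \<tau> :: real
  assumes m: "odd m" and \<zeta>: "\<zeta> ^ m = 1"
    and \<rho>: "\<And>k. 0 < \<rho> k" "\<And>k. \<rho> k < 1" "\<rho> \<longlonglongrightarrow> 1"
    and x: "x \<longlonglongrightarrow> - exp (of_real \<tau>)" and \<tau>: "0 < \<tau>" "real m * \<tau> < ln 2"
  shows "(\<lambda>k. partial_theta (\<zeta> * of_real (\<rho> k)) (x k)) \<longlonglongrightarrow>
          (\<Sum>r<m. \<zeta> ^ tri r * (- exp (of_real \<tau>)) ^ r) / (1 + exp (of_real (real m * \<tau>)))"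
proof -
  obtain h where h: "m = 2 * h + 1" using m by (rule oddE)
  have m0: "m > 0" using h by simp
  have "norm \<zeta> ^ m = 1" using \<zeta> by (metis norm_one norm_power)
  hence n\<zeta>: "norm \<zeta> = 1" using m0 power_eq_imp_eq_base[of "norm \<zeta>" m 1] by simp
  hence \<zeta>0: "\<zeta> \<noteq> 0" by auto
  define X0 :: complex where "X0 = - exp (of_real (real m * \<tau>))"
  have xm: "(- exp (of_real \<tau>)) ^ m = X0"
    using m by (simp add: X0_def flip: exp_of_nat_mult)
  define E where "E = exp (real m * \<tau>)"
  have X0E: "X0 = - of_real E" by (simp add: X0_def E_def exp_of_real[symmetric])
  have "exp (real m * \<tau>) < exp (ln 2)" using \<tau>(2) by (simp only: exp_less_mono)
  hence E: "1 < E" "E < 2" using \<tau> m0 by (auto simp: E_def)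
  have X0: "norm X0 > 1" "norm (1 + X0) < 1" "norm (1 + 1 / X0) < 1"
  proof -
    show "norm X0 > 1" using E by (simp add: X0E)
    have "1 + X0 = of_real (1 - E)" by (simp add: X0E)
    thus "norm (1 + X0) < 1" using E by (simp only: norm_of_real; auto)
    have "1 + 1 / X0 = of_real (1 - 1 / E)" by (simp add: X0E)
    thus "norm (1 + 1 / X0) < 1" using E by (simp only: norm_of_real; auto)
  qed
  define q where "q = (\<lambda>k. \<zeta> * of_real (\<rho> k))"
  have q: "norm (q k) < 1" "q k \<noteq> 0" for k
    using \<rho>(1,2)[of k] \<zeta>0 n\<zeta> by (auto simp: q_def norm_mult)
  have qm: "q k ^ (m * i) = of_real (\<rho> k ^ (m * i))" for k i
  proof -
    have "q k ^ (m * i) = (\<zeta> ^ m) ^ i * of_real (\<rho> k ^ (m * i))"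
      by (simp add: q_def power_mult_distrib power_mult)
    thus ?thesis by (simp add: \<zeta>)
  qed
  have \<rho>lim: "(\<lambda>k. \<rho> k ^ i) \<longlonglongrightarrow> 1" for i
    using tendsto_power[OF \<rho>(3), of i] by simp
  have qlim: "q \<longlonglongrightarrow> \<zeta>"
    using tendsto_mult[OF tendsto_const tendsto_of_real[OF \<rho>(3)], of \<zeta>] by (simp add: q_def)
  have Xlim: "(\<lambda>k. x k ^ m * q k ^ (m * r) / q k ^ (m * h)) \<longlonglongrightarrow> X0" for r
  proof -
    have "(\<lambda>k. x k ^ m * of_real (\<rho> k ^ (m * r)) / of_real (\<rho> k ^ (m * h))) \<longlonglongrightarrow>
            (- exp (of_real \<tau>)) ^ m * of_real 1 / of_real 1"
      by (intro tendsto_intros x \<rho>lim) auto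
    thus ?thesis by (simp only: qm xm of_real_1 mult_1_right div_by_1)
  qed
  have inner: "(\<lambda>k. partial_theta (q k ^ (m * m)) (x k ^ m * q k ^ (m * r) / q k ^ (m * h)))
                 \<longlonglongrightarrow> 1 / (1 - X0)" for r
    unfolding qm[of _ m]
  proof (rule partial_theta_tendsto_outside[OF _ _ _ Xlim X0])
    show "0 < \<rho> k ^ (m * m)" for k using \<rho>(1)[of k] by simp
    show "\<rho> k ^ (m * m) < 1" for k
      using \<rho>(1,2)[of k] m0 by (simp add: power_less_one_iff)
    show "(\<lambda>k. \<rho> k ^ (m * m)) \<longlonglongrightarrow> 1" by (rule \<rho>lim)
  qed
  have "(\<lambda>k. \<Sum>r<m. q k ^ tri r * x k ^ r *
            partial_theta (q k ^ (m * m)) (x k ^ m * q k ^ (m * r) / q k ^ (m * h)))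
         \<longlonglongrightarrow> (\<Sum>r<m. \<zeta> ^ tri r * (- exp (of_real \<tau>)) ^ r * (1 / (1 - X0)))"
    by (intro tendsto_sum tendsto_mult tendsto_power qlim x inner)
  also have "(\<lambda>k. \<Sum>r<m. q k ^ tri r * x k ^ r *
            partial_theta (q k ^ (m * m)) (x k ^ m * q k ^ (m * r) / q k ^ (m * h))) =
           (\<lambda>k. partial_theta (q k) (x k))"
    by (rule ext) (rule partial_theta_dissection[OF q h, symmetric])
  also have "(\<Sum>r<m. \<zeta> ^ tri r * (- exp (of_real \<tau>)) ^ r * (1 / (1 - X0))) =
     (\<Sum>r<m. \<zeta> ^ tri r * (- exp (of_real \<tau>)) ^ r) / (1 + exp (of_real (real m * \<tau>)))"
    by (simp add: X0_def sum_divide_distrib)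
  finally show ?thesis by (simp add: q_def)
qed

text \<open>
  The sum is a polynomial in \<open>- exp \<tau>\<close> with constant term \<open>1\<close>, so it has only finitely many roots.
\<close>

lemma nonzero_root_of_unity_sum:
  fixes \<zeta> :: complex
  assumes "m > 0" "b > 0"
  obtains \<tau> where "0 < \<tau>" "\<tau> < b" "(\<Sum>r<m. \<zeta> ^ tri r * (- exp (of_real \<tau>)) ^ r) \<noteq> 0"
proof -
  define p where "p = (\<lambda>z. \<Sum>i\<le>m - 1. \<zeta> ^ tri i * z ^ i)"
  have fin: "finite {z. p z = 0}"
    unfolding p_def by (subst polyfun_finite_roots) (auto intro!: exI[of _ 0])
  have "inj_on (\<lambda>\<tau>::real. - exp (complex_of_real \<tau>)) {0<..<b}"
    by (rule inj_onI) (simp add: exp_of_real)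
  hence "infinite ((\<lambda>\<tau>::real. - exp (complex_of_real \<tau>)) ` {0<..<b})"
    using assms(2) by (simp add: finite_image_iff)
  hence "\<not> (\<lambda>\<tau>::real. - exp (complex_of_real \<tau>)) ` {0<..<b} \<subseteq> {z. p z = 0}"
    using fin finite_subset by blast
  then obtain \<tau> where \<tau>: "\<tau> \<in> {0<..<b}" "p (- exp (of_real \<tau>)) \<noteq> 0" by blast
  have "{..m - 1} = {..<m}" using assms(1) by auto
  thus ?thesis using \<tau> by (intro that[of \<tau>]) (auto simp: p_def)
qed

section \<open>Accumulation of the spectrum\<close>

text \<open>
  The zero found by \<open>outer_zero\<close> at \<open>\<tau> = 7\<close> is continued over a disc around \<open>7\<close> by \<open>disc_branch\<close>; the
  circles of \<open>partial_theta_nonzero_on_circles\<close> keep it bounded. Along \<open>[6, 7]\<close> the continued zero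
  remains within relative distance \<open>1/n\<close> of \<open>- exp \<tau>\<close>, since by \<open>outer_zero\<close> it is never at relative
  distance exactly \<open>1/n\<close>.
\<close>

lemma tracking_branch:
  fixes \<zeta> :: complex and n :: nat and s :: real
  defines "q \<equiv> \<lambda>\<tau>. \<zeta> * exp (- \<tau> / of_nat n)"
  assumes \<zeta>: "norm \<zeta> = 1" "\<zeta> ^ n = 1" and n: "n \<ge> 2" "exp (real n) > 8 * real n * exp 9"
    and s: "1 < s" "s < 7"
    and free: "\<And>\<tau>. \<tau> \<in> ball 7 7 \<Longrightarrow> q \<tau> \<notin> partial_theta_spectrum"
  obtains \<phi> where "zero_branch q (ball 7 s) \<phi>"
    "\<And>\<tau>. 6 \<le> \<tau> \<Longrightarrow> \<tau> \<le> 7 \<Longrightarrow> norm (\<phi> (of_real \<tau>) * exp (- of_real \<tau>) + 1) < 1 / real n"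
proof -
  have n0: "real n > 0" using n by simp
  have \<zeta>0: "\<zeta> \<noteq> 0" using \<zeta> by auto
  have normq: "norm (q \<tau>) = exp (- Re \<tau> / real n)" for \<tau>
    using \<zeta> by (simp add: q_def norm_mult)
  have q0: "q \<tau> \<noteq> 0" for \<tau> using \<zeta>0 by (simp add: q_def)
  have Re_ge: "7 - d \<le> Re \<tau>" if "\<tau> \<in> cball 7 d" for d :: real and \<tau> :: complex
    using that abs_Re_le_cmod[of "7 - \<tau>"] by (simp add: dist_norm)
  have Re_pos: "0 < Re \<tau>" if "\<tau> \<in> ball 7 7" for \<tau> :: complex
    using that abs_Re_le_cmod[of "7 - \<tau>"] by (simp add: dist_norm)
  interpret spectrum_free_parameter "ball 7 7" q
  proof
    show "q holomorphic_on ball 7 7"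
      unfolding q_def using n0 by (intro holomorphic_intros) auto
    show "norm (q \<tau>) < 1" if "\<tau> \<in> ball 7 7" for \<tau>
      using Re_pos[OF that] n0 by (simp add: normq)
  qed (use free in auto)
  \<comment> \<open>The largest modulus of \<open>q \<tau>\<close> on the closed disc of radius \<open>s\<close> around \<open>7\<close>.\<close>
  define r1 where "r1 = exp (- (7 - s) / real n)"
  have r1: "0 \<le> r1" "r1 < 1" using s n0 by (auto simp: r1_def divide_less_0_iff)
  obtain k0 where k0: "\<And>k q x. k0 \<le> k \<Longrightarrow> q \<noteq> 0 \<Longrightarrow> norm q \<le> r1 \<Longrightarrow>
     norm x = 1 / (sqrt (norm q) * norm q ^ k) \<Longrightarrow> partial_theta q x \<noteq> 0"
    by (rule partial_theta_nonzero_on_circles[OF r1]) (rule that)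
  have q7: "norm (q (of_real \<tau>)) = exp (- \<tau> / real n)" "q (of_real \<tau>) ^ n = exp (- of_real \<tau>)" for \<tau>
  proof -
    show "norm (q (of_real \<tau>)) = exp (- \<tau> / real n)" by (simp add: normq)
    have "q (of_real \<tau>) ^ n = \<zeta> ^ n * exp (of_nat n * (- of_real \<tau> / of_nat n))"
      unfolding q_def power_mult_distrib by (simp only: exp_of_nat_mult)
    thus "q (of_real \<tau>) ^ n = exp (- of_real \<tau>)" using \<zeta> n0 by simp
  qed
  obtain y where y: "norm (y + 1) < 1 / real n" "partial_theta (q (of_real 7)) (exp (of_real 7) * y) = 0"
    using outer_zero(2)[OF n _ _ q7[of 7]] by auto
  define a where "a = exp (of_real 7) * y"
  have "(\<lambda>k. norm (q 7) ^ k) \<longlonglongrightarrow> 0"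
    using norm_q[of 7] by (intro LIMSEQ_realpow_zero) auto
  hence "(\<lambda>k. norm a * norm (q 7) ^ k) \<longlonglongrightarrow> norm a * 0"
    by (intro tendsto_mult tendsto_const)
  hence "\<forall>\<^sub>F k in sequentially. norm a * norm (q 7) ^ k < 1"
    by (rule order_tendstoD(2)) simp
  hence "\<forall>\<^sub>F k in sequentially. k \<ge> k0 \<and> norm a * norm (q 7) ^ k < 1"
    using eventually_ge_at_top[of k0] by eventually_elim auto
  then obtain k where k: "k \<ge> k0" "norm a * norm (q 7) ^ k < 1"
    by (auto simp: eventually_at_top_linorder)
  \<comment> \<open>The index \<open>k\<close> is so large that the zero-free circle encloses the initial zero \<open>a\<close>.\<close>
  define R where "R = (\<lambda>\<tau>. 1 / (sqrt (norm (q \<tau>)) * norm (q \<tau>) ^ k))"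
  obtain \<phi> where \<phi>: "zero_branch q (ball 7 s) \<phi>" "\<phi> 7 = a"
  proof (rule disc_branch[of s 7 R a])
    show "0 < s" using s by simp
    show "cball 7 s \<subseteq> ball (7::complex) 7" using s by auto
    show "continuous_on (cball 7 s) R"
      unfolding R_def q_def using n0 \<zeta>0 by (intro continuous_intros) auto
    fix \<tau> x :: complex assume \<tau>: "\<tau> \<in> cball 7 s" and x: "norm x = R \<tau>"
    have "norm (q \<tau>) \<le> r1"
      using Re_ge[OF \<tau>] divide_right_mono[of "- Re \<tau>" "- (7 - s)" "real n"]
      by (simp add: normq r1_def)
    thus "partial_theta (q \<tau>) x \<noteq> 0"
      using k0[OF k(1) q0] x by (simp add: R_def)
  next
    show "partial_theta (q 7) a = 0" using y(2) by (simp add: a_def)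
    have "sqrt (norm (q 7)) < 1" using norm_q[of 7] by simp
    hence "norm a * (sqrt (norm (q 7)) * norm (q 7) ^ k) \<le> norm a * (1 * norm (q 7) ^ k)"
      by (intro mult_left_mono mult_right_mono) auto
    also have "\<dots> < 1" using k(2) by simp
    finally show "norm a < R 7" using q0[of 7] by (simp add: R_def field_simps)
  qed (rule that)
  define h where "h = (\<lambda>\<tau>::real. norm (\<phi> (of_real \<tau>) * exp (- of_real \<tau>) + 1))"
  have in_ball: "complex_of_real \<tau> \<in> ball 7 s" if "\<tau> \<in> {6..7}" for \<tau>
  proof -
    have "dist 7 (complex_of_real \<tau>) = dist 7 \<tau>" using dist_of_real[of 7 \<tau>] by simp
    thus ?thesis using that s by (simp add: dist_real_def)
  qed
  have cont\<phi>: "continuous_on (ball 7 s) \<phi>"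
    using \<phi>(1) holomorphic_on_imp_continuous_on unfolding zero_branch_def by blast
  have "continuous_on {6..7} (\<lambda>\<tau>. \<phi> (complex_of_real \<tau>))"
    by (rule continuous_on_compose2[OF cont\<phi>]) (use in_ball in \<open>auto intro!: continuous_intros\<close>)
  hence "continuous_on {6..7} h" unfolding h_def by (intro continuous_intros)
  hence conn: "connected (h ` {6..7})" by (rule connected_continuous_image) simp
  have h_ne: "h \<tau> \<noteq> 1 / real n" if "\<tau> \<in> {6..7}" for \<tau>
  proof
    assume eq: "h \<tau> = 1 / real n"
    have \<tau>: "6 \<le> \<tau>" "\<tau> \<le> 7" using that by auto
    have "partial_theta (q (of_real \<tau>)) (\<phi> (of_real \<tau>)) = 0"
      using \<phi>(1) in_ball[OF that] by (simp add: zero_branch_def)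
    moreover have "exp (of_real \<tau>) * (\<phi> (of_real \<tau>) * exp (- of_real \<tau>)) = \<phi> (of_real \<tau>)"
      by (simp add: exp_minus)
    ultimately have "partial_theta (q (of_real \<tau>))
        (exp (of_real \<tau>) * (\<phi> (of_real \<tau>) * exp (- of_real \<tau>))) = 0"
      by (simp only:)
    with outer_zero(1)[OF n \<tau> q7 eq[unfolded h_def]] show False by contradiction
  qed
  have h7: "h 7 < 1 / real n"
    using y(1) by (simp add: h_def \<phi>(2) a_def exp_minus mult.commute[of _ y] mult.assoc)
  show ?thesis
  proof (rule that[OF \<phi>(1)])
    fix \<tau> :: real assume \<tau>: "6 \<le> \<tau>" "\<tau> \<le> 7"
    show "norm (\<phi> (of_real \<tau>) * exp (- of_real \<tau>) + 1) < 1 / real n"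
    proof (rule ccontr)
      assume "\<not> ?thesis"
      hence "1 / real n \<le> h \<tau>" by (simp add: h_def)
      moreover have "h 7 \<in> h ` {6..7}" "h \<tau> \<in> h ` {6..7}" using \<tau> by auto
      ultimately have "1 / real n \<in> h ` {6..7}"
        using connectedD_interval[OF conn, of "h 7" "h \<tau>" "1 / real n"] h7 by simp
      then obtain u where "u \<in> {6..7}" "1 / real n = h u" by (rule imageE)
      thus False using h_ne[of u] by simp
    qed
  qed
qed

text \<open>
  The branches \<open>\<phi> k\<close> are close to \<open>- exp \<tau>\<close> on \<open>[6, 7]\<close> only by estimates, but the normality of their
  reciprocals propagates this to the whole disc, where it contradicts the limit of \<open>\<Theta>\<close> at \<open>\<zeta>\<close> for
  small \<open>\<tau>\<close>.
\<close>

lemma spectrum_near_odd_root_of_unity: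
  assumes m: "odd m" and \<zeta>: "\<zeta> ^ m = 1" and \<delta>: "\<delta> > 0"
  shows "\<exists>q\<in>partial_theta_spectrum. dist q \<zeta> < \<delta>"
proof (rule ccontr)
  assume "\<not> ?thesis"
  hence free: "q \<notin> partial_theta_spectrum" if "dist q \<zeta> < \<delta>" for q using that by blast
  have m0: "m > 0" using m by (cases m) auto
  have "norm \<zeta> ^ m = 1" using \<zeta> by (metis norm_one norm_power)
  hence n\<zeta>: "norm \<zeta> = 1" using m0 power_eq_imp_eq_base[of "norm \<zeta>" m 1] by simp
  have b: "min 1 (ln 2 / real m) > 0" using m0 by simp
  obtain \<tau> where \<tau>: "0 < \<tau>" "\<tau> < min 1 (ln 2 / real m)"
      "(\<Sum>r<m. \<zeta> ^ tri r * (- exp (of_real \<tau>)) ^ r) \<noteq> 0"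
    by (rule nonzero_root_of_unity_sum[OF m0 b, of \<zeta>]) (rule that)
  have m\<tau>: "real m * \<tau> < ln 2" using \<tau>(2) m0 by (simp add: field_simps)
  \<comment> \<open>The disc of radius \<open>s\<close> around \<open>7\<close> contains \<open>\<tau>\<close>, and its closure lies in the right half-plane.\<close>
  define s where "s = 7 - \<tau> / 2"
  have s: "1 < s" "s < 7" using \<tau> by (auto simp: s_def)
  obtain d where d: "d > 0" "\<And>z::complex. norm z < d \<Longrightarrow> norm (exp z - 1) < \<delta>"
  proof -
    have "isCont exp (0::complex)" by (intro continuous_intros)
    then obtain d where "d > 0" "\<And>z::complex. dist z 0 < d \<Longrightarrow> dist (exp z) (exp 0) < \<delta>"
      unfolding continuous_at_eps_delta using \<delta> by blast
    thus ?thesis by (intro that[of d]) (auto simp: dist_norm)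
  qed
  \<comment> \<open>Multiples of \<open>m\<close>, so that \<open>q^n = exp (- \<tau>)\<close> without a factor \<open>\<zeta>^n\<close>.\<close>
  define N where "N = (\<lambda>k::nat. m * Suc k)"
  have N_ge: "real (N k) \<ge> real k" for k
  proof -
    have "k \<le> 1 * Suc k" by simp
    also have "\<dots> \<le> m * Suc k" using m0 by (intro mult_right_mono) auto
    finally show ?thesis by (simp only: N_def of_nat_le_iff)
  qed
  have N_top: "filterlim (\<lambda>k. real (N k)) at_top sequentially"
    by (rule filterlim_at_top_mono[OF filterlim_real_sequentially]) (use N_ge in auto)
  \<comment> \<open>Since \<open>|\<tau>| < 14\<close> on the disc, the last condition brings \<open>\<zeta> exp (- \<tau>/n)\<close> within \<open>\<delta>\<close> of \<open>\<zeta>\<close>.\<close>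
  have "\<forall>\<^sub>F x in at_top. exp x > 8 * x * exp 9 \<and> x \<ge> 2 \<and> x > 14 / (d::real)"
  proof -
    have "\<forall>\<^sub>F x in at_top. exp x > 8 * x * exp (9::real)" by real_asymp
    thus ?thesis using eventually_ge_at_top[of 2] eventually_gt_at_top[of "14 / d"]
      by eventually_elim auto
  qed
  hence "\<forall>\<^sub>F k in sequentially. exp (real (N k)) > 8 * real (N k) * exp 9 \<and>
           real (N k) \<ge> 2 \<and> real (N k) > 14 / d"
    using N_top by (rule eventually_compose_filterlim)
  then obtain K where K: "\<And>k. k \<ge> K \<Longrightarrow> exp (real (N k)) > 8 * real (N k) * exp 9"
      "\<And>k. k \<ge> K \<Longrightarrow> real (N k) \<ge> 2" "\<And>k. k \<ge> K \<Longrightarrow> real (N k) > 14 / d"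
    unfolding eventually_at_top_linorder by blast
  define n where "n = (\<lambda>k. N (k + K))"
  define q where "q = (\<lambda>k \<tau>. \<zeta> * exp (- \<tau> / of_nat (n k)))"
  have n_top: "filterlim (\<lambda>k. real (n k)) at_top sequentially"
    unfolding n_def by (rule filterlim_compose[OF N_top filterlim_add_const_nat_at_top])
  have "\<exists>\<phi>. zero_branch (q k) (ball 7 s) \<phi> \<and>
      (\<forall>\<tau>. 6 \<le> \<tau> \<and> \<tau> \<le> 7 \<longrightarrow> norm (\<phi> (of_real \<tau>) * exp (- of_real \<tau>) + 1) < 1 / real (n k))" for k
  proof -
    have nk: "n k \<ge> 2" "exp (real (n k)) > 8 * real (n k) * exp 9" "real (n k) > 14 / d"
      using K[of "k + K"] by (auto simp: n_def)
    have \<zeta>n: "\<zeta> ^ n k = 1" by (simp only: n_def N_def power_mult \<zeta> power_one)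
    have "\<zeta> * exp (- \<sigma> / of_nat (n k)) \<notin> partial_theta_spectrum" if \<sigma>: "\<sigma> \<in> ball 7 7" for \<sigma>
    proof (rule free)
      have "norm \<sigma> \<le> norm (7 - \<sigma>) + norm (7::complex)"
        using norm_triangle_ineq4[of 7 "7 - \<sigma>"] by (simp add: add.commute)
      also have "\<dots> < 14" using \<sigma> by (simp add: dist_norm)
      finally have "norm (- \<sigma> / of_nat (n k)) < d"
        using nk(1,3) d(1) by (simp add: norm_divide field_simps)
      from d(2)[OF this] have "norm \<zeta> * norm (exp (- \<sigma> / of_nat (n k)) - 1) < \<delta>"
        using n\<zeta> by simp
      thus "dist (\<zeta> * exp (- \<sigma> / of_nat (n k))) \<zeta> < \<delta>"
        unfolding dist_norm norm_mult[symmetric] by (simp add: algebra_simps)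
    qed
    then obtain \<phi> where "zero_branch (\<lambda>\<tau>. \<zeta> * exp (- \<tau> / of_nat (n k))) (ball 7 s) \<phi>"
      "\<And>\<tau>. 6 \<le> \<tau> \<Longrightarrow> \<tau> \<le> 7 \<Longrightarrow> norm (\<phi> (of_real \<tau>) * exp (- of_real \<tau>) + 1) < 1 / real (n k)"
      using tracking_branch[OF n\<zeta> \<zeta>n nk(1,2) s] by blast
    thus ?thesis unfolding q_def by blast
  qed
  then obtain \<phi> where \<phi>: "\<And>k. zero_branch (q k) (ball 7 s) (\<phi> k)"
    "\<And>k \<tau>. 6 \<le> \<tau> \<Longrightarrow> \<tau> \<le> 7 \<Longrightarrow>
      norm (\<phi> k (of_real \<tau>) * exp (- of_real \<tau>) + 1) < 1 / real (n k)"
    by metis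
  have n0: "real (n k) > 0" for k using K(2)[of "k + K"] by (simp add: n_def)
  have normq: "norm (q k \<sigma>) < 1" if "\<sigma> \<in> ball 7 s" for k \<sigma>
  proof -
    have "0 < Re \<sigma>" using that s abs_Re_le_cmod[of "7 - \<sigma>"] by (simp add: dist_norm)
    thus ?thesis using n\<zeta> n0[of k] by (simp add: q_def norm_mult)
  qed
  have \<phi>zero: "partial_theta (q k \<sigma>) (\<phi> k \<sigma>) = 0" if "\<sigma> \<in> ball 7 s" for k \<sigma>
    using \<phi>(1) that by (simp add: zero_branch_def)
  have \<phi>ge: "norm (\<phi> k \<sigma>) \<ge> 1 / 2" if "\<sigma> \<in> ball 7 s" for k \<sigma>
    by (rule partial_theta_zero_norm_ge[OF normq[OF that] \<phi>zero[OF that]])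
  define w where "w = (\<lambda>k \<sigma>. 1 / \<phi> k \<sigma>)"
  have w_hol: "w k holomorphic_on ball 7 s" for k
  proof -
    have "\<phi> k holomorphic_on ball 7 s" using \<phi>(1)[of k] by (simp add: zero_branch_def)
    moreover have "\<phi> k \<sigma> \<noteq> 0" if "\<sigma> \<in> ball 7 s" for \<sigma> using \<phi>ge[OF that, of k] by auto
    ultimately show ?thesis unfolding w_def by (intro holomorphic_intros) auto
  qed
  have w_le: "norm (w k \<sigma>) \<le> 2" if "\<sigma> \<in> ball 7 s" for k \<sigma>
  proof -
    have "norm (w k \<sigma>) = 1 / norm (\<phi> k \<sigma>)" by (simp add: w_def norm_divide)
    also have "\<dots> \<le> 1 / (1 / 2)" using \<phi>ge[OF that, of k] by (intro divide_left_mono) auto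
    finally show ?thesis by simp
  qed
  obtain g r where g: "g holomorphic_on ball 7 s" "strict_mono (r :: nat \<Rightarrow> nat)"
    "\<And>x. x \<in> ball 7 s \<Longrightarrow> (\<lambda>k. w (r k) x) \<longlonglongrightarrow> g x"
  proof (rule Montel[of "ball 7 s" "range w" w])
    show "h holomorphic_on ball 7 s" if "h \<in> range w" for h using that w_hol by auto
    show "\<exists>B. \<forall>h\<in>range w. \<forall>z\<in>K. norm (h z) \<le> B" if "K \<subseteq> ball 7 s" for K
      using that w_le by (intro exI[of _ 2]) auto
  qed (use that in auto)
  define I where "I = complex_of_real ` {6..7}"
  have I_ball: "I \<subseteq> ball 7 s"
  proof
    fix x assume "x \<in> I"
    then obtain t where t: "x = of_real t" "t \<in> {6..7}" by (auto simp: I_def)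
    have "dist 7 (complex_of_real t) = dist 7 t" using dist_of_real[of 7 t] by simp
    thus "x \<in> ball 7 s" using t s by (simp add: dist_real_def)
  qed
  have \<phi>lim: "(\<lambda>k. \<phi> (r k) (of_real t)) \<longlonglongrightarrow> - exp (of_real t)" if t: "t \<in> {6..7}" for t
  proof -
    have "(\<lambda>k. 1 / real (n k)) \<longlonglongrightarrow> 0"
      by (rule tendsto_divide_0[OF tendsto_const filterlim_at_top_imp_at_infinity[OF n_top]])
    hence "(\<lambda>k. \<phi> k (of_real t) * exp (- of_real t) + 1) \<longlonglongrightarrow> 0"
      by (rule Lim_null_comparison[rotated]) (use \<phi>(2)[of t] t in \<open>auto intro!: always_eventually less_imp_le\<close>)
    hence "(\<lambda>k. (\<phi> (r k) (of_real t) * exp (- of_real t) + 1 - 1) * exp (of_real t)) \<longlonglongrightarrow> (0 - 1) * exp (of_real t)"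
      by (intro tendsto_intros LIMSEQ_subseq_LIMSEQ[OF _ g(2), unfolded o_def])
    thus ?thesis by (simp add: exp_minus mult.assoc)
  qed
  have gI: "g z + exp (- z) = 0" if zI: "z \<in> I" for z
  proof -
    obtain t where t: "z = of_real t" "t \<in> {6..7}" using zI unfolding I_def by blast
    have "(\<lambda>k. w (r k) z) \<longlonglongrightarrow> 1 / (- exp z)"
      unfolding w_def t(1) by (intro tendsto_divide tendsto_const \<phi>lim t) simp
    moreover have "(\<lambda>k. w (r k) z) \<longlonglongrightarrow> g z" using g(3) I_ball zI by blast
    ultimately have "g z = 1 / (- exp z)" by (rule LIMSEQ_unique[rotated])
    thus ?thesis by (simp add: exp_minus field_simps)
  qed
  have seven: "(7::complex) \<in> I" unfolding I_def by (rule image_eqI[of _ _ 7]) auto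
  have "connected I" unfolding I_def by (intro connected_continuous_image continuous_intros) auto
  moreover have "I \<noteq> {7}"
  proof -
    have "(6::complex) \<in> I" unfolding I_def by (rule image_eqI[of _ _ 6]) auto
    thus ?thesis by auto
  qed
  ultimately have limpt: "(7::complex) islimpt I" using connected_imp_perfect seven by blast
  have \<tau>ball: "complex_of_real \<tau> \<in> ball 7 s"
  proof -
    have "dist 7 (complex_of_real \<tau>) = dist 7 \<tau>" using dist_of_real[of 7 \<tau>] by simp
    thus ?thesis using \<tau> by (simp add: dist_real_def s_def)
  qed
  have "g (of_real \<tau>) + exp (- of_real \<tau>) = 0"
  proof (rule analytic_continuation[of "\<lambda>z. g z + exp (- z)" "ball 7 s" I 7])
    show "(\<lambda>z. g z + exp (- z)) holomorphic_on ball 7 s" by (intro holomorphic_intros g(1))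
  qed (use limpt I_ball \<tau>ball gI s in auto)
  hence g\<tau>: "g (of_real \<tau>) = - exp (- of_real \<tau>)" by (simp add: add_eq_0_iff)
  have "(\<lambda>k. 1 / w (r k) (of_real \<tau>)) \<longlonglongrightarrow> 1 / g (of_real \<tau>)"
    by (intro tendsto_divide tendsto_const g(3) \<tau>ball) (simp add: g\<tau>)
  hence x: "(\<lambda>k. \<phi> (r k) (of_real \<tau>)) \<longlonglongrightarrow> - exp (of_real \<tau>)"
    by (simp add: g\<tau> w_def exp_minus inverse_eq_divide)
  define \<rho> where "\<rho> = (\<lambda>k. exp (- \<tau> / real (n (r k))))"
  have \<rho>: "0 < \<rho> k" "\<rho> k < 1" for k using \<tau> n0[of "r k"] by (auto simp: \<rho>_def)
  have "filterlim (\<lambda>k. real (n (r k))) at_top sequentially"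
    by (rule filterlim_compose[OF n_top filterlim_subseq[OF g(2)]])
  hence "(\<lambda>k. - \<tau> / real (n (r k))) \<longlonglongrightarrow> 0"
    by (rule tendsto_divide_0[OF tendsto_const filterlim_at_top_imp_at_infinity])
  from tendsto_exp[OF this] have \<rho>1: "\<rho> \<longlonglongrightarrow> 1" by (simp add: \<rho>_def[abs_def])
  have "partial_theta (\<zeta> * of_real (\<rho> k)) (\<phi> (r k) (of_real \<tau>)) = 0" for k
  proof -
    have "\<zeta> * of_real (\<rho> k) = q (r k) (of_real \<tau>)" by (simp add: q_def \<rho>_def exp_of_real[symmetric])
    thus ?thesis using \<phi>zero[OF \<tau>ball, of "r k"] by simp
  qed
  with partial_theta_tendsto_at_root_of_unity[OF m \<zeta> \<rho> \<rho>1 x \<tau>(1) m\<tau>]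
  have "(\<lambda>k. 0) \<longlonglongrightarrow> (\<Sum>r<m. \<zeta> ^ tri r * (- exp (of_real \<tau>)) ^ r) / (1 + exp (complex_of_real (real m * \<tau>)))"
    by simp
  hence "(\<Sum>r<m. \<zeta> ^ tri r * (- exp (of_real \<tau>)) ^ r) / (1 + exp (complex_of_real (real m * \<tau>))) = 0"
    by (rule LIMSEQ_unique[OF _ tendsto_const])
  moreover have "1 + exp (complex_of_real (real m * \<tau>)) \<noteq> 0"
  proof -
    have "0 < 1 + exp (real m * \<tau>)" using exp_gt_zero[of "real m * \<tau>"] by linarith
    moreover have "1 + exp (complex_of_real (real m * \<tau>)) = of_real (1 + exp (real m * \<tau>))"
      by (simp only: exp_of_real of_real_add of_real_1)
    ultimately show ?thesis by (simp only: of_real_eq_0_iff)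
  qed
  ultimately show False using \<tau>(3) by simp
qed

lemma odd_roots_of_unity_dense:
  fixes z :: complex
  assumes z: "norm z = 1" and \<epsilon>: "\<epsilon> > 0"
  obtains m \<zeta> where "odd m" "\<zeta> ^ m = 1" "dist \<zeta> z < \<epsilon>"
proof -
  define \<theta> where "\<theta> = Arg z"
  have "z \<noteq> 0" using z by auto
  hence z\<theta>: "z = exp (\<i> * of_real \<theta>)" using z Arg_eq[of z] by (simp add: \<theta>_def)
  obtain M :: nat where M: "real M > 2 * pi / \<epsilon>" using reals_Archimedean2 by blast
  define m where "m = 2 * M + 1"
  have m: "real m > 2 * pi / \<epsilon>" "real m > 0" using M by (auto simp: m_def)
  define p where "p = \<lfloor>\<theta> * real m / (2 * pi)\<rfloor>"
  define \<alpha> where "\<alpha> = 2 * pi * of_int p / real m"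
  define \<zeta> where "\<zeta> = exp (\<i> * of_real \<alpha>)"
  \<comment> \<open>The angle \<open>\<alpha>\<close> is the multiple of \<open>2\<pi>/m\<close> just below \<open>\<theta>\<close>.\<close>
  have "\<zeta> ^ m = exp (of_nat m * (\<i> * of_real \<alpha>))" by (simp add: \<zeta>_def exp_of_nat_mult)
  also have "of_nat m * (\<i> * of_real \<alpha>) = 2 * of_real pi * \<i> * of_int p"
    using m(2) by (simp add: \<alpha>_def field_simps)
  also have "exp \<dots> = 1" by (simp add: exp_eq_1)
  finally have 1: "\<zeta> ^ m = 1" .
  have "of_int p \<le> \<theta> * real m / (2 * pi)" "\<theta> * real m / (2 * pi) < of_int p + 1"
    unfolding p_def by linarith+
  hence "0 \<le> \<theta> * real m - 2 * pi * of_int p" "\<theta> * real m - 2 * pi * of_int p < 2 * pi"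
    by (simp_all add: field_simps)
  hence "0 \<le> (\<theta> - \<alpha>) * real m" "(\<theta> - \<alpha>) * real m < 2 * pi"
    using m(2) by (simp_all add: \<alpha>_def left_diff_distrib)
  hence "0 \<le> \<theta> - \<alpha>" "\<theta> - \<alpha> < 2 * pi / real m"
    using m(2) by (simp_all add: zero_le_mult_iff field_simps)
  moreover have "2 * pi / real m < \<epsilon>" using m \<epsilon> by (simp add: field_simps)
  ultimately have ab: "\<bar>\<alpha> - \<theta>\<bar> < \<epsilon>" by linarith
  have "\<zeta> - z = z * (exp (\<i> * of_real (\<alpha> - \<theta>)) - 1)"
    by (simp add: \<zeta>_def z\<theta> algebra_simps flip: exp_add)
  hence "dist \<zeta> z = norm (exp (\<i> * of_real (\<alpha> - \<theta>)) - 1)"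
    using z by (simp add: dist_norm norm_mult del: of_real_diff)
  also have "\<dots> = 2 * \<bar>sin ((\<alpha> - \<theta>) / 2)\<bar>" by (rule dist_exp_i_1)
  also have "\<dots> \<le> 2 * \<bar>(\<alpha> - \<theta>) / 2\<bar>" by (rule mult_left_mono[OF abs_sin_x_le_abs_x]) simp
  also have "\<dots> < \<epsilon>" using ab by simp
  finally have "dist \<zeta> z < \<epsilon>" .
  thus ?thesis using that[of m \<zeta>] 1 by (simp add: m_def)
qed

theorem corollary7p7:
  shows "(\<forall>z \<in> sphere (0::complex) 1. z islimpt partial_theta_spectrum) \<and>
         closure partial_theta_spectrum \<inter> sphere 0 1 = sphere 0 1"
proof -
  have clos: "z \<in> closure partial_theta_spectrum" if z: "z \<in> sphere 0 1" for z
    unfolding closure_approachable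
  proof (intro allI impI)
    fix e :: real assume e: "e > 0"
    have nz: "norm z = 1" "e / 2 > 0" using z e by auto
    obtain m \<zeta> where \<zeta>: "odd m" "\<zeta> ^ m = 1" "dist \<zeta> z < e / 2"
      by (rule odd_roots_of_unity_dense[OF nz]) (rule that)
    obtain q where q: "q \<in> partial_theta_spectrum" "dist q \<zeta> < e / 2"
      using spectrum_near_odd_root_of_unity[OF \<zeta>(1,2) nz(2)] by blast
    have "dist q z \<le> dist q \<zeta> + dist \<zeta> z" by (rule dist_triangle)
    hence "dist q z < e" using q(2) \<zeta>(3) by linarith
    thus "\<exists>q\<in>partial_theta_spectrum. dist q z < e" using q(1) by blast
  qed
  have "z islimpt partial_theta_spectrum" if z: "z \<in> sphere 0 1" for z
  proof -
    have "z \<notin> partial_theta_spectrum" using z by (simp add: partial_theta_spectrum_def)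
    thus ?thesis using clos[OF z] by (simp add: closure_def)
  qed
  thus ?thesis using clos by blast
qed

end
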